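(* Let $K$ be a field of characteristic zero, let $n\ge 1$, and let $Q_n=K(x_1,\ldots,x_n)$ be the field of rational functions in $n$ variables over $K$. Let $E_n=\mathrm{Der}_K(Q_n)$ be the Lie algebra (over $K$) of $K$-derivations of $Q_n$. Then the group homomorphism $$\mathrm{Aut}_{K\text{-alg}}(Q_n)\to \mathrm{Aut}_{\mathrm{Lie}}(E_n),\qquad \sigma\mapsto \big(\partial\mapsto \sigma\partial\sigma^{-1}\big),$$ is an isomorphism of groups.
   Context: The Lie bracket on $E_n$ is the commutator $[\partial,\delta]=\partial\delta-\delta\partial$. $\mathrm{Aut}_{K\text{-alg}}(Q_n)$ denotes the group of $K$-algebra automorphisms of $Q_n$, and $\mathrm{Aut}_{\mathrm{Lie}}(E_n)$ denotes the group of automorphisms of $E_n$ as a Lie algebra over $K$. *)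

theory Defs
  imports Complex_Main "HOL-Library.Poly_Mapping" "HOL-Computational_Algebra.Fraction_Field" "HOL-Algebra.Bij"
begin

text \<open>
  The field \<open>K(x\<^sub>1, \<dots>, x\<^sub>n)\<close> is the field of fractions of the polynomial ring
  \<open>K[x\<^sub>1, \<dots>, x\<^sub>n]\<close>, whose elements are the finitely supported functions from exponent
  vectors \<open>'n \<Rightarrow>\<^sub>0 nat\<close> to the coefficient field \<open>'k\<close> (with convolution as product).  The
  variables are indexed by a finite linearly ordered type \<open>'n\<close>, so that \<open>n = CARD('n) \<ge> 1\<close>;
  the order only serves the library's proof that the polynomial ring is an integral domain.
\<close>

type_synonym ('k, 'n) rat_fun = "(('n \<Rightarrow>\<^sub>0 nat) \<Rightarrow>\<^sub>0 'k) fract"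

definition rf_const :: "'k::field \<Rightarrow> ('k, 'n::{finite,linorder}) rat_fun" where
  "rf_const c = Fract (Poly_Mapping.single 0 c) 1"

definition rf_scale ::
    "'k::field \<Rightarrow> ('k, 'n::{finite,linorder}) rat_fun \<Rightarrow> ('k, 'n) rat_fun" where
  "rf_scale c f = rf_const c * f"

text \<open>
  Below, \<open>s\<close> is the scalar multiplication of a commutative algebra \<open>'q\<close> over the field \<open>'k\<close>.
\<close>

definition derivations :: "('k::field \<Rightarrow> 'q::comm_ring_1 \<Rightarrow> 'q) \<Rightarrow> ('q \<Rightarrow> 'q) set" where
  "derivations s =
    {d. Vector_Spaces.linear s s d \<and> (\<forall>a b. d (a * b) = d a * b + a * d b)}"

definition commutator :: "('q \<Rightarrow> 'q) \<Rightarrow> ('q \<Rightarrow> 'q) \<Rightarrow> 'q \<Rightarrow> 'q::comm_ring_1" where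
  "commutator d e = (\<lambda>a. d (e a) - e (d a))"

definition alg_auts :: "('k::field \<Rightarrow> 'q::comm_ring_1 \<Rightarrow> 'q) \<Rightarrow> ('q \<Rightarrow> 'q) set" where
  "alg_auts s =
    {\<sigma>. bij \<sigma> \<and> Vector_Spaces.linear s s \<sigma> \<and> \<sigma> 1 = 1 \<and> (\<forall>a b. \<sigma> (a * b) = \<sigma> a * \<sigma> b)}"

text \<open>
  The automorphisms of a Lie algebra \<open>L\<close> of operators on \<open>'q\<close> (with pointwise vector space
  operations and the commutator as bracket).  As elements of \<open>Bij L\<close> they are extensional
  functions, i.e. they are \<open>undefined\<close> outside \<open>L\<close>.
\<close>

definition lie_auts ::
    "('k::field \<Rightarrow> 'q::comm_ring_1 \<Rightarrow> 'q) \<Rightarrow> ('q \<Rightarrow> 'q) set \<Rightarrow> (('q \<Rightarrow> 'q) \<Rightarrow> 'q \<Rightarrow> 'q) set" where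
  "lie_auts s L =
    {\<phi> \<in> Bij L.
      (\<forall>d\<in>L. \<forall>e\<in>L. \<phi> (\<lambda>a. d a + e a) = (\<lambda>a. \<phi> d a + \<phi> e a)) \<and>
      (\<forall>c. \<forall>d\<in>L. \<phi> (\<lambda>a. s c (d a)) = (\<lambda>a. s c (\<phi> d a))) \<and>
      (\<forall>d\<in>L. \<forall>e\<in>L. \<phi> (commutator d e) = commutator (\<phi> d) (\<phi> e))}"

definition alg_aut_group :: "('k::field \<Rightarrow> 'q::comm_ring_1 \<Rightarrow> 'q) \<Rightarrow> ('q \<Rightarrow> 'q) monoid" where
  "alg_aut_group s = BijGroup UNIV \<lparr>carrier := alg_auts s\<rparr>"

definition lie_aut_group ::
    "('k::field \<Rightarrow> 'q::comm_ring_1 \<Rightarrow> 'q) \<Rightarrow> ('q \<Rightarrow> 'q) set \<Rightarrow> (('q \<Rightarrow> 'q) \<Rightarrow> 'q \<Rightarrow> 'q) monoid" where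
  "lie_aut_group s L = BijGroup L \<lparr>carrier := lie_auts s L\<rparr>"

lemma rf_const_0: "rf_const 0 = 0"
  and rf_const_1: "rf_const 1 = 1"
  and rf_const_add: "rf_const (a + b) = rf_const a + rf_const b"
  and rf_const_mult: "rf_const (a * b) = rf_const a * rf_const b"
  by (simp_all add: rf_const_def single_add mult_single Zero_fract_def One_fract_def)

lemma vector_space_rf_scale: "vector_space rf_scale"
  by unfold_locales
    (simp_all add: rf_scale_def rf_const_1 rf_const_add rf_const_mult algebra_simps)

lemma restrict_UNIV: "restrict f UNIV = f"
  by (simp add: restrict_def)

lemma vector_space_linear_iff:
  assumes "vector_space s"
  shows "Vector_Spaces.linear s s f \<longleftrightarrow>
    (\<forall>a b. f (a + b) = f a + f b) \<and> (\<forall>c a. f (s c a) = s c (f a))"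
  using assms by (simp add: Vector_Spaces.linear_iff)

lemma derivations_closed:
  fixes s :: "'k::field \<Rightarrow> 'q::comm_ring_1 \<Rightarrow> 'q"
  assumes s: "vector_space s" and s_mult: "\<And>c a b. s c (a * b) = s c a * b"
    and d: "d \<in> derivations s" and e: "e \<in> derivations s"
  shows "(\<lambda>a. d a + e a) \<in> derivations s"
    and "(\<lambda>a. s c (d a)) \<in> derivations s"
    and "commutator d e \<in> derivations s"
proof -
  have s_mult': "s c (a * b) = a * s c b" for c a b
    using s_mult[of c b a] by (simp add: mult.commute)
  interpret vector_space s by (fact s)
  have diff: "d (a - b) = d a - d b" "e (a - b) = e a - e b" for a b
    using d e by (auto simp: derivations_def linear_iff_module_hom intro: module_hom.diff)
  show "(\<lambda>a. d a + e a) \<in> derivations s"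
    using d e by (simp add: derivations_def vector_space_linear_iff[OF s] scale_right_distrib algebra_simps)
  show "(\<lambda>a. s c (d a)) \<in> derivations s"
    using d by (simp add: derivations_def vector_space_linear_iff[OF s] scale_right_distrib
        scale_left_commute s_mult[symmetric] s_mult'[symmetric])
  show "commutator d e \<in> derivations s"
    using d e by (simp add: derivations_def vector_space_linear_iff[OF s] commutator_def
        scale_right_diff_distrib algebra_simps)
qed

lemma group_alg_aut_group:
  assumes s: "vector_space s"
  shows "group (alg_aut_group s)"
proof -
  interpret B: group "BijGroup UNIV" by (rule group_BijGroup)
  have "subgroup (alg_auts s) (BijGroup UNIV)"
  proof (rule B.subgroupI)
    show "alg_auts s \<subseteq> carrier (BijGroup UNIV)"
      by (auto simp: alg_auts_def BijGroup_def Bij_def)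
    have "id \<in> alg_auts s" by (simp add: alg_auts_def vector_space_linear_iff[OF s])
    thus "alg_auts s \<noteq> {}" by blast
  next
    fix f assume f: "f \<in> alg_auts s"
    hence b: "bij f" by (simp add: alg_auts_def)
    hence "f \<in> Bij UNIV" by (simp add: Bij_def)
    hence "inv\<^bsub>BijGroup UNIV\<^esub> f = inv_into UNIV f" by (simp add: inv_BijGroup restrict_UNIV)
    moreover have "inv_into UNIV f \<in> alg_auts s"
      using f b unfolding alg_auts_def vector_space_linear_iff[OF s] mem_Collect_eq
      by (intro conjI allI bij_imp_bij_inv; (subst inv_f_eq)?)
        (auto simp: bij_is_inj bij_is_surj surj_f_inv_f)
    ultimately show "inv\<^bsub>BijGroup UNIV\<^esub> f \<in> alg_auts s" by simp
  next
    fix f g assume "f \<in> alg_auts s" "g \<in> alg_auts s"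
    moreover from this have "f \<otimes>\<^bsub>BijGroup UNIV\<^esub> g = f \<circ> g"
      by (auto simp: alg_auts_def BijGroup_def Bij_def compose_def)
    ultimately show "f \<otimes>\<^bsub>BijGroup UNIV\<^esub> g \<in> alg_auts s"
      by (simp add: alg_auts_def vector_space_linear_iff[OF s] bij_comp)
  qed
  thus ?thesis
    unfolding alg_aut_group_def by (rule B.subgroup_imp_group)
qed

lemma group_lie_aut_group:
  assumes add: "\<And>d e. d \<in> L \<Longrightarrow> e \<in> L \<Longrightarrow> (\<lambda>a. d a + e a) \<in> L"
    and scale: "\<And>c d. d \<in> L \<Longrightarrow> (\<lambda>a. s c (d a)) \<in> L"
    and comm: "\<And>d e. d \<in> L \<Longrightarrow> e \<in> L \<Longrightarrow> commutator d e \<in> L"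
  shows "group (lie_aut_group s L)"
proof -
  interpret B: group "BijGroup L" by (rule group_BijGroup)
  have "subgroup (lie_auts s L) (BijGroup L)"
  proof (rule B.subgroupI)
    show "lie_auts s L \<subseteq> carrier (BijGroup L)"
      by (auto simp: lie_auts_def BijGroup_def)
    have "(\<lambda>d\<in>L. d) \<in> lie_auts s L"
      by (simp add: lie_auts_def id_Bij add scale comm)
    thus "lie_auts s L \<noteq> {}" by blast
  next
    fix f assume f: "f \<in> lie_auts s L"
    hence B: "f \<in> Bij L" by (simp add: lie_auts_def)
    let ?g = "restrict (inv_into L f) L"
    have g: "?g d \<in> L" "f (?g d) = d" if "d \<in> L" for d
      using B that by (auto simp: Bij_def bij_betw_def inv_into_into f_inv_into_f)
    have gI: "?g d = e" if "e \<in> L" "f e = d" "d \<in> L" for d e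
      using B that by (auto simp: Bij_def bij_betw_def)
    have "?g \<in> lie_auts s L"
      unfolding lie_auts_def
    proof (intro CollectI conjI ballI allI)
      show "?g \<in> Bij L" by (rule restrict_inv_into_Bij[OF B])
    next
      fix d e assume "d \<in> L" "e \<in> L"
      thus "?g (\<lambda>a. d a + e a) = (\<lambda>a. ?g d a + ?g e a)"
        using f g by (intro gI) (auto simp: lie_auts_def add simp del: restrict_apply)
    next
      fix c d assume "d \<in> L"
      thus "?g (\<lambda>a. s c (d a)) = (\<lambda>a. s c (?g d a))"
        using f g by (intro gI) (auto simp: lie_auts_def scale simp del: restrict_apply)
    next
      fix d e assume "d \<in> L" "e \<in> L"
      thus "?g (commutator d e) = commutator (?g d) (?g e)"
        using f g by (intro gI) (auto simp: lie_auts_def comm simp del: restrict_apply)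
    qed
    thus "inv\<^bsub>BijGroup L\<^esub> f \<in> lie_auts s L" by (simp add: inv_BijGroup[OF B])
  next
    fix f g assume "f \<in> lie_auts s L" "g \<in> lie_auts s L"
    moreover from this have "f \<otimes>\<^bsub>BijGroup L\<^esub> g = compose L f g" "g \<in> L \<rightarrow> L"
      by (simp_all add: lie_auts_def BijGroup_def Bij_imp_funcset)
    ultimately show "f \<otimes>\<^bsub>BijGroup L\<^esub> g \<in> lie_auts s L"
      by (auto simp: lie_auts_def compose_Bij compose_eq add scale comm Pi_iff)
  qed
  thus ?thesis
    unfolding lie_aut_group_def by (rule B.subgroup_imp_group)
qed

lemma group_rat_fun_auts:
  shows "group (alg_aut_group (rf_scale :: 'k::field \<Rightarrow> ('k, 'n::{finite,linorder}) rat_fun \<Rightarrow> _))"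
    and "group (lie_aut_group (rf_scale :: 'k \<Rightarrow> ('k, 'n) rat_fun \<Rightarrow> _) (derivations rf_scale))"
proof -
  have mult: "rf_scale c (a * b) = rf_scale c a * b" for c :: 'k and a b :: "('k, 'n) rat_fun"
    by (simp add: rf_scale_def mult.assoc)
  show "group (alg_aut_group (rf_scale :: 'k \<Rightarrow> ('k, 'n) rat_fun \<Rightarrow> _))"
    by (rule group_alg_aut_group[OF vector_space_rf_scale])
  show "group (lie_aut_group (rf_scale :: 'k \<Rightarrow> ('k, 'n) rat_fun \<Rightarrow> _) (derivations rf_scale))"
    by (intro group_lie_aut_group derivations_closed[OF vector_space_rf_scale mult])
qed

end

theory Submission
  imports Defs "HOL-Analysis.Cartesian_Space"
begin

text \<open>
  Write \<open>\<partial>\<^sub>i\<close> for the partial derivatives and \<open>\<delta>\<^sub>i = \<phi>(\<partial>\<^sub>i)\<close> for an automorphism \<open>\<phi>\<close> of the Lie algebra \<open>E\<^sub>n\<close>.  The centralizer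
  of all \<open>\<delta>\<^sub>i\<close> is their \<open>K\<close>-span, since this holds for the \<open>\<partial>\<^sub>i\<close>; this forces the constants of the \<open>\<delta>\<^sub>i\<close> to
  be \<open>K\<close>, hence the \<open>\<delta>\<^sub>i\<close> to be linearly independent over \<open>Q\<^sub>n\<close>, i.e. a basis of \<open>E\<^sub>n\<close>.  The image
  \<open>\<Sum>\<^sub>k y\<^sub>k \<delta>\<^sub>k\<close> of the Euler derivation \<open>\<Sum>\<^sub>k x\<^sub>k \<partial>\<^sub>k\<close> provides \<open>y\<^sub>k\<close> with \<open>\<delta>\<^sub>k y\<^sub>k = 1\<close> and \<open>\<delta>\<^sub>j y\<^sub>k = 0\<close> for \<open>j \<noteq> k\<close>.  Induction on the
  degree, with the grading by the Euler derivation to eliminate the ambiguity, gives \<open>\<phi>(p(x) \<partial>\<^sub>i) = p(y) \<delta>\<^sub>i\<close>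
  for polynomials \<open>p\<close>, and brackets with polynomial multiples of the \<open>\<partial>\<^sub>j\<close> extend this to all rational
  functions \<open>f\<close>.  So \<open>\<phi>(f \<partial>\<^sub>i) = \<sigma>(f) \<delta>\<^sub>i\<close> for an automorphism \<open>\<sigma>\<close> of \<open>Q\<^sub>n\<close>, and \<open>\<phi>(d) = \<sigma> d \<sigma>\<^sup>-\<^sup>1\<close>.
\<close>

section \<open>Derivations of a field over \<open>K\<close>\<close>

locale field_algebra =
  fixes emb :: "'k::field_char_0 \<Rightarrow> 'f::field"
  assumes emb_0: "emb 0 = 0" and emb_1: "emb 1 = 1"
    and emb_add: "emb (a + b) = emb a + emb b"
    and emb_mult: "emb (a * b) = emb a * emb b"
begin

abbreviation Der :: "('f \<Rightarrow> 'f) set" where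
  "Der \<equiv> derivations (\<lambda>c. (*) (emb c))"

lemma vector_space_emb: "vector_space (\<lambda>c. (*) (emb c))"
  by unfold_locales (simp_all add: emb_1 emb_add emb_mult algebra_simps)

lemma emb_minus: "emb (- a) = - emb a"
  using emb_add[of a "- a"] by (simp add: emb_0 add_eq_0_iff2)

lemma emb_of_nat: "emb (of_nat n) = of_nat n"
  by (induction n) (simp_all add: emb_0 emb_1 emb_add)

lemma emb_eq_0_iff: "emb a = 0 \<longleftrightarrow> a = 0"
proof
  assume "emb a = 0"
  hence "emb (a * inverse a) = 0"
    by (simp add: emb_mult)
  thus "a = 0"
    by (metis emb_1 right_inverse zero_neq_one)
qed (simp add: emb_0)

lemma of_nat_eq_0_iff': "(of_nat n :: 'f) = 0 \<longleftrightarrow> n = 0"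
  using emb_eq_0_iff[of "of_nat n"] by (simp add: emb_of_nat)

lemma Der_iff:
  "d \<in> Der \<longleftrightarrow> (\<forall>a b. d (a + b) = d a + d b) \<and> (\<forall>c a. d (emb c * a) = emb c * d a) \<and>
    (\<forall>a b. d (a * b) = d a * b + a * d b)"
  unfolding derivations_def by (simp add: vector_space_linear_iff[OF vector_space_emb])

context
  fixes d assumes d: "d \<in> Der"
begin

lemma der_add: "d (a + b) = d a + d b"
  and der_scale: "d (emb c * a) = emb c * d a"
  and der_mult: "d (a * b) = d a * b + a * d b"
  using d by (auto simp: Der_iff)

lemma der_0: "d 0 = 0"
  using der_add[of 0 0] by (metis add_0 add_cancel_right_right)

lemma der_1: "d 1 = 0"
  using der_mult[of 1 1] by (metis add_cancel_right_right mult_1 mult_1_right)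

lemma der_emb: "d (emb c) = 0"
  using der_scale[of c 1] by (simp add: der_1)

lemma der_minus: "d (- a) = - d a"
  using der_add[of a "- a"] by (simp add: der_0 add_eq_0_iff2)

lemma der_diff: "d (a - b) = d a - d b"
  using der_add[of a "- b"] by (simp add: der_minus)

lemma der_sum: "d (sum f A) = (\<Sum>a\<in>A. d (f a))"
  by (induction A rule: infinite_finite_induct) (simp_all add: der_0 der_add)

lemma der_divide: "b \<noteq> 0 \<Longrightarrow> d (a / b) = (d a * b - a * d b) / b^2"
  using der_mult[of "a / b" b] by (simp add: field_simps power2_eq_square)

lemma der_power: "d (a ^ n) = of_nat n * a ^ (n - 1) * d a"
proof (induction n)
  case (Suc n)
  thus ?case by (cases n) (simp_all add: der_mult der_1 algebra_simps)
qed (simp add: der_1)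

lemma der_prod_eq_0: "(\<And>i. i \<in> A \<Longrightarrow> d (f i) = 0) \<Longrightarrow> d (prod f A) = 0"
  by (induction A rule: infinite_finite_induct) (simp_all add: der_1 der_mult)

lemma Der_smult: "(\<lambda>a. f * d a) \<in> Der"
  unfolding Der_iff by (simp add: der_add der_emb der_mult algebra_simps)

end

lemma Der_zero: "(\<lambda>a. 0) \<in> Der"
  unfolding Der_iff by simp

lemma Der_add: "d \<in> Der \<Longrightarrow> e \<in> Der \<Longrightarrow> (\<lambda>a. d a + e a) \<in> Der"
  by (rule derivations_closed(1)[OF vector_space_emb]) simp_all

lemma Der_diff: "d \<in> Der \<Longrightarrow> e \<in> Der \<Longrightarrow> (\<lambda>a. d a - e a) \<in> Der"
  using Der_add[OF _ Der_smult, of d e "- 1"] by simp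

lemma Der_sum: "(\<And>i. i \<in> A \<Longrightarrow> d i \<in> Der) \<Longrightarrow> (\<lambda>a. \<Sum>i\<in>A. d i a) \<in> Der"
  by (induction A rule: infinite_finite_induct) (simp_all add: Der_zero Der_add)

lemma Der_commutator: "d \<in> Der \<Longrightarrow> e \<in> Der \<Longrightarrow> commutator d e \<in> Der"
  by (rule derivations_closed(3)[OF vector_space_emb]) simp_all

end

section \<open>Monomials and polynomials evaluated at a family of field elements\<close>

definition monom_at :: "('n::finite \<Rightarrow> 'f::comm_monoid_mult) \<Rightarrow> ('n \<Rightarrow> nat) \<Rightarrow> 'f" where
  "monom_at Y \<alpha> = (\<Prod>k\<in>UNIV. Y k ^ \<alpha> k)"

lemma monom_at_split: "monom_at Y \<alpha> = Y j ^ \<alpha> j * (\<Prod>k\<in>UNIV - {j}. Y k ^ \<alpha> k)"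
  unfolding monom_at_def by (rule prod.remove) simp_all

lemma monom_at_upd: "monom_at Y (\<alpha>(j := m)) = Y j ^ m * (\<Prod>k\<in>UNIV - {j}. Y k ^ \<alpha> k)"
  by (subst monom_at_split[of _ _ j]) simp

lemma monom_at_0: "monom_at Y (\<lambda>_. 0) = 1"
  by (simp add: monom_at_def)

lemma monom_at_add: "monom_at Y (\<lambda>k. \<alpha> k + \<beta> k) = monom_at Y \<alpha> * monom_at Y \<beta>"
  by (simp add: monom_at_def power_add prod.distrib)

lemma monom_at_var: "monom_at Y ((\<lambda>_. 0)(j := Suc 0)) = Y j"
  by (simp add: monom_at_upd)

context field_algebra
begin

lemma der_monom_at:
  assumes d: "d \<in> Der" and dY: "\<And>k. d (Y k) = (if k = j then 1 else 0)"
  shows "d (monom_at Y \<alpha>) = of_nat (\<alpha> j) * monom_at Y (\<alpha>(j := \<alpha> j - 1))"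
proof -
  have "d (\<Prod>k\<in>UNIV - {j}. Y k ^ \<alpha> k) = 0"
    by (rule der_prod_eq_0[OF d]) (simp add: der_power[OF d] dY)
  thus ?thesis
    unfolding monom_at_upd monom_at_split[of Y \<alpha> j]
    by (simp add: der_mult[OF d] der_power[OF d] dY)
qed

text \<open>Euler's identity for homogeneous polynomials: each operator \<open>Y j * d j\<close>
  multiplies the monomial by its exponent at \<open>j\<close>.\<close>

lemma euler_monom_at:
  fixes d :: "'n::finite \<Rightarrow> 'f \<Rightarrow> 'f"
  assumes d: "\<And>i. d i \<in> Der" and dY: "\<And>j k. d j (Y k) = (if k = j then 1 else 0)"
  shows "(\<Sum>j\<in>UNIV. Y j * d j (monom_at Y \<alpha>)) = of_nat (sum \<alpha> UNIV) * monom_at Y \<alpha>"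
proof -
  have "Y j * d j (monom_at Y \<alpha>) = of_nat (\<alpha> j) * monom_at Y \<alpha>" for j
    unfolding der_monom_at[OF d dY] monom_at_upd
    by (cases "\<alpha> j") (simp_all add: monom_at_split[of Y \<alpha> j] mult_ac)
  thus ?thesis by (simp add: sum_distrib_right)
qed

text \<open>The pairs consisting of the values of one and the same polynomial at \<open>X\<close> and at \<open>Y\<close>.\<close>

inductive poly_values :: "('n::finite \<Rightarrow> 'f) \<Rightarrow> ('n \<Rightarrow> 'f) \<Rightarrow> 'f \<Rightarrow> 'f \<Rightarrow> bool"
  for X Y :: "'n::finite \<Rightarrow> 'f" where
  monom: "poly_values X Y (emb c * monom_at X \<alpha>) (emb c * monom_at Y \<alpha>)"
| add: "poly_values X Y p p' \<Longrightarrow> poly_values X Y q q' \<Longrightarrow> poly_values X Y (p + q) (p' + q')"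

abbreviation polynomial_in :: "('n::finite \<Rightarrow> 'f) \<Rightarrow> 'f \<Rightarrow> bool" where
  "polynomial_in X p \<equiv> poly_values X X p p"

lemma poly_values_emb: "poly_values X Y (emb c) (emb c)"
  using poly_values.monom[of X Y c "\<lambda>_. 0"] by (simp add: monom_at_0)

lemma poly_values_var: "poly_values X Y (X j) (Y j)"
  using poly_values.monom[of X Y 1 "(\<lambda>_. 0)(j := Suc 0)"] by (simp add: monom_at_var emb_1)

lemma poly_values_monom_mult:
  "poly_values X Y q q' \<Longrightarrow> poly_values X Y (emb c * monom_at X \<alpha> * q) (emb c * monom_at Y \<alpha> * q')"
proof (induction rule: poly_values.induct)
  case (monom d \<beta>)
  show ?case
    using poly_values.monom[of X Y "c * d" "\<lambda>k. \<alpha> k + \<beta> k"]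
    by (simp add: emb_mult monom_at_add mult_ac)
next
  case add
  thus ?case using poly_values.add by (fastforce simp: distrib_left)
qed

lemma poly_values_mult:
  "poly_values X Y p p' \<Longrightarrow> poly_values X Y q q' \<Longrightarrow> poly_values X Y (p * q) (p' * q')"
proof (induction rule: poly_values.induct)
  case add
  thus ?case using poly_values.add by (fastforce simp: distrib_right)
qed (rule poly_values_monom_mult)

lemma poly_values_minus: "poly_values X Y p p' \<Longrightarrow> poly_values X Y (- p) (- p')"
  using poly_values_mult[OF poly_values_emb[of X Y "- 1"]] by (simp add: emb_minus emb_1)

lemma poly_values_diff:
  "poly_values X Y p p' \<Longrightarrow> poly_values X Y q q' \<Longrightarrow> poly_values X Y (p - q) (p' - q')"
  using poly_values.add[OF _ poly_values_minus] by fastforce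

lemma poly_values_exists: "polynomial_in X p \<Longrightarrow> \<exists>p'. poly_values X Y p p'"
  by (induction p p rule: poly_values.induct) (blast intro: poly_values.intros)+

text \<open>By \<open>der_monom_at\<close>, \<open>d\<close> and \<open>e\<close> act on monomials
  by the same formula, so both results are values of one polynomial, the \<open>j\<close>-th partial
  derivative.\<close>

lemma poly_values_der:
  assumes d: "d \<in> Der" and dX: "\<And>k. d (X k) = (if k = j then 1 else 0)"
    and e: "e \<in> Der" and eY: "\<And>k. e (Y k) = (if k = j then 1 else 0)"
    and "poly_values X Y p p'"
  shows "poly_values X Y (d p) (e p')"
  using assms(5)
proof (induction rule: poly_values.induct)
  case (monom c \<alpha>)
  show ?case
    using poly_values.monom[of X Y "c * of_nat (\<alpha> j)" "\<alpha>(j := \<alpha> j - 1)"]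
    by (simp add: der_scale d e der_monom_at[OF d dX] der_monom_at[OF e eY] emb_mult emb_of_nat mult_ac)
qed (simp add: der_add d e poly_values.add)

end

section \<open>The image of the vector fields under a Lie algebra automorphism\<close>

locale rational_function_field = field_algebra emb
  for emb :: "'k::field_char_0 \<Rightarrow> 'f::field" +
  fixes X :: "'n::finite \<Rightarrow> 'f" and D :: "'n \<Rightarrow> 'f \<Rightarrow> 'f"
  assumes D: "D i \<in> Der"
    and D_X: "D i (X j) = (if j = i then 1 else 0)"
    and fraction: "\<exists>p q. polynomial_in X p \<and> polynomial_in X q \<and> q \<noteq> 0 \<and> f = p / q"
    and D_const: "(\<And>i. D i f = 0) \<Longrightarrow> f \<in> range emb"
begin

text \<open>The difference kills the \<open>X j\<close>, hence all monomials and polynomials, and by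
  the quotient rule all fractions.\<close>

lemma Der_eqI:
  assumes d: "d \<in> Der" and e: "e \<in> Der" and eq: "\<And>j. d (X j) = e (X j)"
  shows "d = e"
proof -
  define u where "u = (\<lambda>a. d a - e a)"
  have u: "u \<in> Der"
    unfolding u_def by (rule Der_diff[OF d e])
  have uX: "u (X j) = 0" for j
    by (simp add: u_def eq)
  have mon: "u (monom_at X \<alpha>) = 0" for \<alpha>
    unfolding monom_at_def by (rule der_prod_eq_0[OF u]) (simp add: der_power[OF u] uX)
  have pol: "u p = 0" if "poly_values X X p q" for p q
    using that by (induction rule: poly_values.induct) (simp_all add: der_add[OF u] der_scale[OF u] mon)
  show ?thesis
  proof
    fix f
    obtain p q where "polynomial_in X p" "polynomial_in X q" "q \<noteq> 0" "f = p / q"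
      using fraction by blast
    hence "u f = 0"
      by (simp add: der_divide[OF u] pol)
    thus "d f = e f" by (simp add: u_def)
  qed
qed

lemma Der_expand:
  assumes d: "d \<in> Der"
  shows "d = (\<lambda>a. \<Sum>k\<in>UNIV. d (X k) * D k a)"
  by (rule Der_eqI[OF d Der_sum[OF Der_smult[OF D]]]) (simp add: D_X if_distrib cong: if_cong)

text \<open>The commutator is a derivation that kills every \<open>X k\<close>, because the values
  \<open>D i (X k)\<close> are 0 or 1.\<close>

lemma D_commute: "D i (D j a) = D j (D i a)"
proof -
  have "commutator (D i) (D j) = (\<lambda>a. 0)"
    by (rule Der_eqI[OF Der_commutator[OF D D] Der_zero])
      (simp add: commutator_def D_X der_0[OF D] der_1[OF D])
  thus ?thesis by (simp add: commutator_def fun_eq_iff)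
qed

end

text \<open>
  Abstracts the properties of \<open>\<psi> i f = \<phi>(f \<partial>\<^sub>i)\<close> for an automorphism \<open>\<phi>\<close> of the Lie algebra.
\<close>

locale lie_transport = rational_function_field emb X D
  for emb :: "'k::field_char_0 \<Rightarrow> 'f::field" and X :: "'n::finite \<Rightarrow> 'f" and D :: "'n \<Rightarrow> 'f \<Rightarrow> 'f" +
  fixes \<psi> :: "'n \<Rightarrow> 'f \<Rightarrow> 'f \<Rightarrow> 'f"
  assumes psi_Der: "\<psi> i f \<in> Der"
    and psi_add: "\<psi> i (f + g) a = \<psi> i f a + \<psi> i g a"
    and psi_scale: "\<psi> i (emb c * f) a = emb c * \<psi> i f a"
    and psi_bracket: "\<psi> i f (\<psi> j g a) - \<psi> j g (\<psi> i f a) = \<psi> j (f * D i g) a - \<psi> i (g * D j f) a"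
    and psi_inj: "(\<And>a. (\<Sum>k\<in>UNIV. \<psi> k (F k) a) = 0) \<Longrightarrow> F i = 0"
    and psi_surj: "d \<in> Der \<Longrightarrow> \<exists>F. \<forall>a. d a = (\<Sum>k\<in>UNIV. \<psi> k (F k) a)"
begin

section \<open>Centralizer, constants and independence of the images of the partial
  derivatives\<close>

abbreviation \<delta> :: "'n \<Rightarrow> 'f \<Rightarrow> 'f" where
  "\<delta> i \<equiv> \<psi> i 1"

lemma psi_0: "\<psi> i 0 a = 0"
  using psi_scale[of i 0 0 a] by (simp add: emb_0)

lemma psi_emb: "\<psi> i (emb c) a = emb c * \<delta> i a"
  using psi_scale[of i c 1 a] by simp

lemma psi_minus: "\<psi> i (- f) a = - \<psi> i f a"
  using psi_scale[of i "- 1" f a] by (simp add: emb_minus emb_1)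

lemma psi_sum: "\<psi> i (sum f A) a = (\<Sum>k\<in>A. \<psi> i (f k) a)"
  by (induction A rule: infinite_finite_induct) (simp_all add: psi_0 psi_add)

lemma psi_eq_0:
  assumes "\<And>a. \<psi> i f a = 0"
  shows "f = 0"
  using psi_inj[of "\<lambda>k. if k = i then f else 0" i] assms
  by (simp add: if_distrib[of "\<lambda>f. \<psi> _ f _"] psi_0 cong: if_cong)

lemma delta_psi: "\<delta> i (\<psi> j g a) - \<psi> j g (\<delta> i a) = \<psi> j (D i g) a"
  using psi_bracket[of i 1 j g a] by (simp add: der_1[OF D] psi_0)

lemma delta_commute: "\<delta> i (\<delta> j a) = \<delta> j (\<delta> i a)"
  using delta_psi[of i j 1 a] by (simp add: der_1[OF D] psi_0)

lemma delta_nonzero: "\<exists>a. \<delta> i a \<noteq> 0"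
  using psi_eq_0[of i 1] by auto

text \<open>Bracketing \<open>\<Sum>k. \<psi> k (F k)\<close> with \<open>\<delta> i\<close>
  replaces each \<open>F k\<close> by \<open>D i (F k)\<close>. If the bracket vanishes for every
  \<open>i\<close>, then by \<open>psi_inj\<close> each \<open>F k\<close> is a constant of all
  \<open>D i\<close>, so it lies in \<open>K\<close>.\<close>

lemma centralizer_delta:
  assumes d: "d \<in> Der" and comm: "\<And>i a. \<delta> i (d a) = d (\<delta> i a)"
  shows "\<exists>c. \<forall>a. d a = (\<Sum>k\<in>UNIV. emb (c k) * \<delta> k a)"
proof -
  obtain F where F: "\<And>a. d a = (\<Sum>k\<in>UNIV. \<psi> k (F k) a)"
    using psi_surj[OF d] by blast
  have "D i (F k) = 0" for i k
  proof (rule psi_inj[where F = "\<lambda>k. D i (F k)"])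
    fix a
    have "\<delta> i (d a) - d (\<delta> i a) = (\<Sum>k\<in>UNIV. \<psi> k (D i (F k)) a)"
      unfolding F by (simp add: der_sum[OF psi_Der] sum_subtractf[symmetric] delta_psi)
    thus "(\<Sum>k\<in>UNIV. \<psi> k (D i (F k)) a) = 0"
      by (simp add: comm)
  qed
  hence "\<exists>c. F k = emb c" for k
    using D_const[of "F k"] by blast
  then obtain c where "\<And>k. F k = emb (c k)"
    by metis
  thus ?thesis
    using F by (auto simp: psi_emb)
qed

text \<open>
  If \<open>c\<close> is a constant of all \<open>\<delta> j\<close>, then \<open>c \<delta> i\<close> is in the centralizer of the \<open>\<delta> j\<close>.  Bracketing
  with \<open>\<psi> i (X i)\<close>, which acts like \<open>x\<^sub>i \<partial>\<^sub>i\<close>, shows that \<open>c\<close> is an eigenvector of eigenvalue 1 up to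
  an element of \<open>K\<close>; the same holds for its square, whereas that has eigenvalue 2.
\<close>

lemma delta_const:
  assumes "\<And>j. \<delta> j c = 0"
  shows "c \<in> range emb"
proof -
  fix i :: 'n
  let ?y = "\<psi> i (X i)"
  have eigen: "\<exists>a. ?y c = c - emb a" if const: "\<And>j. \<delta> j c = 0" for c
  proof -
    have "\<exists>a. \<forall>x. c * \<delta> i x = (\<Sum>k\<in>UNIV. emb (a k) * \<delta> k x)"
      by (rule centralizer_delta[OF Der_smult[OF psi_Der]])
        (simp add: der_mult[OF psi_Der] const delta_commute[of _ i])
    then obtain a where a: "\<And>x. c * \<delta> i x = (\<Sum>k\<in>UNIV. emb (a k) * \<delta> k x)"
      by blast
    \<comment> \<open>The bracket of \<open>\<delta> k\<close> with \<open>?y\<close> is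
      \<open>\<psi> i (D k (X i))\<close>, which is \<open>\<delta> i\<close> for
      \<open>k = i\<close> and zero otherwise.\<close>
    have y: "?y (\<delta> k x) = \<delta> k (?y x) - (if i = k then \<delta> i x else 0)" for k x
      using delta_psi[of k i "X i" x] by (auto simp: D_X psi_0 algebra_simps)
    obtain x where x: "\<delta> i x \<noteq> 0"
      using delta_nonzero by blast
    have "?y c * \<delta> i x + c * ?y (\<delta> i x) = ?y (c * \<delta> i x)"
      by (simp add: der_mult[OF psi_Der])
    also have "\<dots> = (\<Sum>k\<in>UNIV. emb (a k) * ?y (\<delta> k x))"
      unfolding a by (simp add: der_sum[OF psi_Der] der_scale[OF psi_Der])
    also have "\<dots> = c * \<delta> i (?y x) - emb (a i) * \<delta> i x"
      unfolding a y right_diff_distrib sum_subtractf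
      by (simp add: if_distrib[of "(*) _"] cong: if_cong)
    finally have "(?y c - (c - emb (a i))) * \<delta> i x = 0"
      by (simp add: y algebra_simps)
    thus ?thesis using x by auto
  qed
  obtain a where a: "?y c = c - emb a"
    using eigen assms by blast
  define b where "b = c - emb a"
  have yb: "?y b = b"
    by (simp add: b_def der_diff[OF psi_Der] der_emb[OF psi_Der] a)
  have "\<delta> j (b * b) = 0" for j
    by (simp add: b_def der_mult[OF psi_Der] der_diff[OF psi_Der] der_emb[OF psi_Der] assms)
  then obtain a' where a': "?y (b * b) = b * b - emb a'"
    using eigen by blast
  \<comment> \<open>The Leibniz rule gives \<open>?y (b * b) = 2 * b * b\<close>; compared with
    \<open>a'\<close>, this puts \<open>b * b\<close> into \<open>K\<close>, where \<open>?y\<close>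
    vanishes.\<close>
  have "b * b = emb (- a')"
    using a' by (simp add: der_mult[OF psi_Der] yb emb_minus)
  hence "?y (b * b) = 0"
    by (metis der_emb[OF psi_Der])
  hence "of_nat 2 * (b * b) = 0"
    by (simp add: der_mult[OF psi_Der] yb)
  hence "b = 0"
    using of_nat_eq_0_iff'[of 2] by simp
  thus ?thesis by (simp add: b_def)
qed

text \<open>A shortest relation, normalized to have a coefficient 1, becomes shorter when
  differentiated by any \<open>\<delta> j\<close>. So all its coefficients are constants of the
  \<open>\<delta> j\<close>, and by \<open>delta_const\<close> it is a relation over
  \<open>K\<close>, which \<open>psi_inj\<close> excludes.\<close>

lemma delta_independent:
  assumes "\<And>a. (\<Sum>k\<in>UNIV. f k * \<delta> k a) = 0"
  shows "f = (\<lambda>_. 0)"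
  using assms
proof (induction "card {k. f k \<noteq> 0}" arbitrary: f rule: less_induct)
  case less
  show ?case
  proof (rule ccontr)
    assume "f \<noteq> (\<lambda>_. 0)"
    then obtain m where m: "f m \<noteq> 0" by auto
    define g where "g = (\<lambda>k. f k / f m)"
    have g: "(\<Sum>k\<in>UNIV. g k * \<delta> k a) = 0" for a
      using less.prems[of a] by (simp add: g_def sum_divide_distrib[symmetric])
    have "(\<lambda>k. \<delta> j (g k)) = (\<lambda>_. 0)" for j
    proof (rule less.hyps)
      have "{k. \<delta> j (g k) \<noteq> 0} \<subseteq> {k. f k \<noteq> 0} - {m}"
        using m by (auto simp: g_def der_0[OF psi_Der] der_1[OF psi_Der])
      hence "card {k. \<delta> j (g k) \<noteq> 0} \<le> card ({k. f k \<noteq> 0} - {m})"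
        by (intro card_mono) auto
      also have "\<dots> < card {k. f k \<noteq> 0}"
        using m by (intro card_Diff1_less) auto
      finally show "card {k. \<delta> j (g k) \<noteq> 0} < card {k. f k \<noteq> 0}" .
    next
      fix a
      \<comment> \<open>As the \<open>\<delta>\<close> commute, the other half of the product rule
        is the same relation evaluated at \<open>\<delta> j a\<close>.\<close>
      have "(\<Sum>k\<in>UNIV. \<delta> j (g k) * \<delta> k a) = \<delta> j (\<Sum>k\<in>UNIV. g k * \<delta> k a) - (\<Sum>k\<in>UNIV. g k * \<delta> k (\<delta> j a))"
        unfolding der_sum[OF psi_Der] der_mult[OF psi_Der] sum.distrib delta_commute[of _ j] by simp
      thus "(\<Sum>k\<in>UNIV. \<delta> j (g k) * \<delta> k a) = 0"
        by (simp add: g der_0[OF psi_Der])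
    qed
    hence "\<exists>c. g k = emb c" for k
      using delta_const[of "g k"] by (auto dest: fun_cong)
    then obtain c where c: "\<And>k. g k = emb (c k)"
      by metis
    have "(\<Sum>k\<in>UNIV. \<psi> k (emb (c k)) a) = 0" for a
      using g[of a] by (simp add: psi_emb c)
    hence "emb (c m) = 0"
      by (rule psi_inj)
    thus False
      using m c[of m] by (simp add: g_def)
  qed
qed

text \<open>A derivation is determined by its values at the \<open>X j\<close>, so independence of
  the \<open>\<delta> k\<close> means that the square matrix of the values
  \<open>\<delta> k (X j)\<close> has independent columns and is invertible.\<close>

lemma delta_expand:
  assumes d: "d \<in> Der"
  shows "\<exists>f. \<forall>a. d a = (\<Sum>k\<in>UNIV. f k * \<delta> k a)"
proof -
  let ?A = "(\<chi> j k. \<delta> k (X j)) :: 'f ^ 'n ^ 'n"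
  have "\<forall>c. (\<Sum>k\<in>UNIV. c k *s column k ?A) = 0 \<longrightarrow> (\<forall>k. c k = 0)"
  proof (intro allI impI)
    fix c k
    assume c: "(\<Sum>k\<in>UNIV. c k *s column k ?A) = 0"
    have "(\<lambda>a. \<Sum>k\<in>UNIV. c k * \<delta> k a) = (\<lambda>a. 0)"
    proof (rule Der_eqI[OF Der_sum[OF Der_smult[OF psi_Der]] Der_zero])
      fix j
      have "(\<Sum>k\<in>UNIV. c k *s column k ?A) $ j = 0"
        by (simp add: c)
      thus "(\<Sum>k\<in>UNIV. c k * \<delta> k (X j)) = 0"
        by (simp add: column_def)
    qed
    hence "c = (\<lambda>_. 0)"
      by (intro delta_independent) (rule fun_cong)
    thus "c k = 0" by simp
  qed
  then obtain B where "B ** ?A = mat 1"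
    using matrix_left_invertible_independent_columns[of ?A] by blast
  hence "?A ** B = mat 1"
    by (simp add: matrix_left_right_inverse)
  hence B: "?A *v (B *v (\<chi> j. d (X j))) = (\<chi> j. d (X j))"
    by (simp add: matrix_vector_mul_assoc)
  \<comment> \<open>The coefficients solve the linear system that prescribes the values of
    \<open>d\<close> at the \<open>X j\<close>.\<close>
  define f where "f k = (B *v (\<chi> j. d (X j))) $ k" for k
  have "d = (\<lambda>a. \<Sum>k\<in>UNIV. f k * \<delta> k a)"
  proof (rule Der_eqI[OF d Der_sum[OF Der_smult[OF psi_Der]]])
    fix j
    show "d (X j) = (\<Sum>k\<in>UNIV. f k * \<delta> k (X j))"
      using arg_cong[OF B, of "\<lambda>v. v $ j"]
      by (simp add: f_def matrix_vector_mult_def mult.commute)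
  qed
  thus ?thesis by (auto simp: fun_eq_iff)
qed

section \<open>The image of the Euler derivation and the coordinates dual to the
  \<open>\<delta> k\<close>\<close>

definition euler :: "'f \<Rightarrow> 'f" where
  "euler a = (\<Sum>k\<in>UNIV. \<psi> k (X k) a)"

lemma euler_Der: "euler \<in> Der"
  unfolding euler_def[abs_def] by (rule Der_sum[OF psi_Der])

lemma delta_euler: "\<delta> j (euler a) - euler (\<delta> j a) = \<delta> j a"
proof -
  have "\<delta> j (euler a) - euler (\<delta> j a) = (\<Sum>k\<in>UNIV. \<psi> k (D j (X k)) a)"
    by (simp add: euler_def der_sum[OF psi_Der] sum_subtractf[symmetric] delta_psi)
  thus ?thesis
    by (simp add: D_X if_distrib[of "\<lambda>f. \<psi> _ f _"] psi_0 cong: if_cong)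
qed

definition Y :: "'n \<Rightarrow> 'f" where
  "Y = (SOME f. \<forall>a. euler a = (\<Sum>k\<in>UNIV. f k * \<delta> k a))"

lemma euler_Y: "euler a = (\<Sum>k\<in>UNIV. Y k * \<delta> k a)"
  using someI_ex[OF delta_expand[OF euler_Der]] unfolding Y_def by blast

text \<open>Bracketing \<open>\<Sum>k. Y k * \<delta> k\<close> with \<open>\<delta> j\<close>
  differentiates the coefficients, and the result is \<open>\<delta> j\<close> by
  \<open>delta_euler\<close>; independence allows comparison of coefficients.\<close>

lemma delta_Y: "\<delta> j (Y k) = (if k = j then 1 else 0)"
proof -
  have "(\<lambda>k. \<delta> j (Y k) - (if k = j then 1 else 0)) = (\<lambda>_. 0)"
  proof (rule delta_independent)
    fix a
    have "(\<Sum>k\<in>UNIV. \<delta> j (Y k) * \<delta> k a) = \<delta> j (euler a) - euler (\<delta> j a)"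
      unfolding euler_Y der_sum[OF psi_Der] der_mult[OF psi_Der] sum.distrib delta_commute[of _ j]
      by simp
    thus "(\<Sum>k\<in>UNIV. (\<delta> j (Y k) - (if k = j then 1 else 0)) * \<delta> k a) = 0"
      by (simp add: delta_euler left_diff_distrib sum_subtractf if_distrib[of "\<lambda>c. c * _"] cong: if_cong)
  qed
  from fun_cong[OF this, of k] show ?thesis by simp
qed

text \<open>The field \<open>monom_at X \<alpha>\<close> times \<open>D i\<close> is homogeneous of
  degree \<open>sum \<alpha> UNIV - 1\<close> for the bracket with the Euler derivation;
  \<open>psi_bracket\<close> transports this.\<close>

lemma euler_psi_monom:
  "euler (\<psi> i (monom_at X \<alpha>) a) - \<psi> i (monom_at X \<alpha>) (euler a)
    = of_nat (sum \<alpha> UNIV) * \<psi> i (monom_at X \<alpha>) a - \<psi> i (monom_at X \<alpha>) a"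
proof -
  let ?f = "monom_at X \<alpha>"
  have "euler (\<psi> i ?f a) - \<psi> i ?f (euler a)
      = (\<Sum>k\<in>UNIV. \<psi> i (X k * D k ?f) a - \<psi> k (?f * D i (X k)) a)"
    unfolding euler_def der_sum[OF psi_Der] sum_subtractf[symmetric] psi_bracket ..
  also have "\<dots> = \<psi> i (\<Sum>k\<in>UNIV. X k * D k ?f) a - \<psi> i ?f a"
  proof -
    have "\<psi> k (?f * D i (X k)) a = (if k = i then \<psi> i ?f a else 0)" for k
      by (simp add: D_X psi_0)
    thus ?thesis by (simp add: sum_subtractf psi_sum)
  qed
  also have "(\<Sum>k\<in>UNIV. X k * D k ?f) = emb (of_nat (sum \<alpha> UNIV)) * ?f"
    unfolding emb_of_nat by (rule euler_monom_at[OF D D_X])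
  finally have "euler (\<psi> i ?f a) - \<psi> i ?f (euler a) = emb (of_nat (sum \<alpha> UNIV)) * \<psi> i ?f a - \<psi> i ?f a"
    by (simp only: psi_scale)
  thus ?thesis by (simp only: emb_of_nat)
qed

lemma euler_monom_delta:
  "euler (monom_at Y \<alpha> * \<delta> i a) - monom_at Y \<alpha> * \<delta> i (euler a)
    = of_nat (sum \<alpha> UNIV) * (monom_at Y \<alpha> * \<delta> i a) - monom_at Y \<alpha> * \<delta> i a"
proof -
  have "euler (monom_at Y \<alpha>) = of_nat (sum \<alpha> UNIV) * monom_at Y \<alpha>"
    unfolding euler_Y by (rule euler_monom_at[OF psi_Der delta_Y])
  moreover have "\<delta> i (euler a) = \<delta> i a + euler (\<delta> i a)"
    using delta_euler[of i a] by (simp add: algebra_simps)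
  ultimately show ?thesis
    by (simp add: der_mult[OF euler_Der] algebra_simps)
qed

text \<open>
  By induction on the degree, both sides have the same brackets with all \<open>\<delta> j\<close>, so their difference
  is in the \<open>K\<close>-span of the \<open>\<delta> j\<close>, where the Euler derivation acts by the eigenvalue -1, whereas it
  acts on both sides by the eigenvalue \<open>\<bar>\<alpha>\<bar> - 1\<close>.
\<close>

lemma psi_monom: "\<psi> i (monom_at X \<alpha>) a = monom_at Y \<alpha> * \<delta> i a"
proof (induction "sum \<alpha> UNIV" arbitrary: i \<alpha> a rule: less_induct)
  case less
  show ?case
  proof (cases "sum \<alpha> UNIV = 0")
    case True
    hence "\<alpha> = (\<lambda>_. 0)" by auto
    thus ?thesis by (simp add: monom_at_0)
  next
    case False
    define u where "u = (\<lambda>a. \<psi> i (monom_at X \<alpha>) a - monom_at Y \<alpha> * \<delta> i a)"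
    have u: "u \<in> Der"
      unfolding u_def by (rule Der_diff[OF psi_Der Der_smult[OF psi_Der]])
    have "\<delta> j (u a) = u (\<delta> j a)" for j a
    proof -
      let ?\<beta> = "\<alpha>(j := \<alpha> j - 1)"
      \<comment> \<open>For \<open>\<alpha> j = 0\<close> truncated subtraction gives
        \<open>?\<beta> = \<alpha>\<close>, out of reach of the induction hypothesis; the factor
        \<open>of_nat (\<alpha> j)\<close> is then zero.\<close>
      have lower: "of_nat (\<alpha> j) * \<psi> i (monom_at X ?\<beta>) a = of_nat (\<alpha> j) * (monom_at Y ?\<beta> * \<delta> i a)"
      proof (cases "\<alpha> j = 0")
        case False
        hence "sum ?\<beta> UNIV < sum \<alpha> UNIV"
          by (intro sum_strict_mono_ex1) auto
        thus ?thesis by (simp add: less.hyps)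
      qed simp
      have "D j (monom_at X \<alpha>) = emb (of_nat (\<alpha> j)) * monom_at X ?\<beta>"
        by (simp add: der_monom_at[OF D D_X] emb_of_nat)
      hence "\<delta> j (\<psi> i (monom_at X \<alpha>) a) - \<psi> i (monom_at X \<alpha>) (\<delta> j a)
          = emb (of_nat (\<alpha> j)) * \<psi> i (monom_at X ?\<beta>) a"
        unfolding delta_psi by (simp only: psi_scale)
      moreover have "\<delta> j (monom_at Y \<alpha> * \<delta> i a) - monom_at Y \<alpha> * \<delta> i (\<delta> j a)
          = of_nat (\<alpha> j) * (monom_at Y ?\<beta> * \<delta> i a)"
        by (simp add: der_mult[OF psi_Der] der_monom_at[OF psi_Der delta_Y] delta_commute[of i])
      ultimately show ?thesis
        using lower by (simp add: emb_of_nat u_def der_diff[OF psi_Der] algebra_simps)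
    qed
    then obtain c where c: "\<And>a. u a = (\<Sum>k\<in>UNIV. emb (c k) * \<delta> k a)"
      using centralizer_delta[OF u] by blast
    have "euler (u a) - u (euler a) = of_nat (sum \<alpha> UNIV) * u a - u a"
    proof -
      have "euler (u a) - u (euler a)
          = (euler (\<psi> i (monom_at X \<alpha>) a) - \<psi> i (monom_at X \<alpha>) (euler a))
            - (euler (monom_at Y \<alpha> * \<delta> i a) - monom_at Y \<alpha> * \<delta> i (euler a))"
        by (simp add: u_def der_diff[OF euler_Der])
      thus ?thesis
        unfolding euler_psi_monom euler_monom_delta by (simp add: u_def right_diff_distrib)
    qed
    moreover have "euler (u a) - u (euler a) = (\<Sum>k\<in>UNIV. emb (c k) * (euler (\<delta> k a) - \<delta> k (euler a)))"
      unfolding c by (simp add: der_sum[OF euler_Der] der_scale[OF euler_Der] sum_subtractf[symmetric] right_diff_distrib)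
    moreover have "euler (\<delta> k a) - \<delta> k (euler a) = - \<delta> k a" for k
      using delta_euler[of k a] by (simp add: algebra_simps)
    \<comment> \<open>The eigenvalues \<open>sum \<alpha> UNIV - 1\<close> and -1 both hold for
      \<open>u\<close>; they differ by the degree, which is nonzero in characteristic 0.\<close>
    ultimately have "of_nat (sum \<alpha> UNIV) * u a = 0"
      by (simp add: sum_negf c)
    hence "u a = 0"
      using False by (metis mult_eq_0_iff of_nat_eq_0_iff')
    thus ?thesis by (simp add: u_def)
  qed
qed

lemma psi_poly: "poly_values X Y p p' \<Longrightarrow> \<psi> i p a = p' * \<delta> i a"
  by (induction rule: poly_values.induct) (simp_all add: psi_scale psi_monom psi_add algebra_simps)

text \<open>This keeps denominators nonzero when they are evaluated at \<open>Y\<close>: a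
  polynomial vanishing there is sent to zero by \<open>\<psi>\<close>, which is injective.\<close>

lemma poly_values_X_eq_0:
  assumes "poly_values X Y p 0"
  shows "p = 0"
proof -
  fix i :: 'n
  show ?thesis by (rule psi_eq_0[of i]) (simp add: psi_poly[OF assms])
qed

text \<open>
  The brackets of both sides with all \<open>\<psi> j (p q\<^sup>2)\<close>, \<open>p\<close> a polynomial, involve only polynomials
  and thus coincide. A derivation commuting with \<open>w\<close> and all multiples \<open>p w\<close> kills all \<open>p\<close>.
\<close>

lemma psi_quotient:
  assumes p: "poly_values X Y p p'" and q: "poly_values X Y q q'" and "q \<noteq> 0"
  shows "\<psi> i (p / q) a = p' / q' * \<delta> i a"
proof -
  have q': "q' \<noteq> 0"
    using q \<open>q \<noteq> 0\<close> poly_values_X_eq_0 by blast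
  define u where "u = (\<lambda>a. \<psi> i (p / q) a - p' / q' * \<delta> i a)"
  have u: "u \<in> Der"
    unfolding u_def by (rule Der_diff[OF psi_Der Der_smult[OF psi_Der]])
  have deriv: "poly_values X Y (D j r) (\<delta> j r')" if "poly_values X Y r r'" for j r r'
    by (rule poly_values_der[OF D D_X psi_Der delta_Y that])
  have comm: "r' * q'^2 * \<delta> j (u a) = u (r' * q'^2 * \<delta> j a)" if r: "poly_values X Y r r'" for r r' j a
  proof -
    define A where "A = r' * q'^2"
    define g where "g = p' / q'"
    have f: "poly_values X Y (r * q^2) A"
      unfolding A_def power2_eq_square by (intro poly_values_mult r q)
    \<comment> \<open>The factor \<open>q^2\<close> cancels the denominator from the quotient
      rule.\<close>
    have "r * q^2 * D j (p / q) = r * (D j p * q - p * D j q)"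
      using \<open>q \<noteq> 0\<close> by (simp add: der_divide[OF D])
    moreover have "A * \<delta> j g = r' * (\<delta> j p' * q' - p' * \<delta> j q')"
      using q' by (simp add: A_def g_def der_divide[OF psi_Der])
    ultimately have 1: "poly_values X Y (r * q^2 * D j (p / q)) (A * \<delta> j g)"
      by (simp only: poly_values_mult poly_values_diff deriv p q r)
    \<comment> \<open>One factor \<open>q\<close> survives differentiation and cancels the
      denominator of \<open>p / q\<close>. The repeated summand, in place of a factor 2, keeps the
      expression within sums and products of known polynomial values.\<close>
    have "D i (r * q^2) = q * (D i r * q + (r * D i q + r * D i q))"
      by (simp add: der_mult[OF D] power2_eq_square algebra_simps)
    hence "p / q * D i (r * q^2) = p * (D i r * q + (r * D i q + r * D i q))"
      using \<open>q \<noteq> 0\<close> by simp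
    moreover have "\<delta> i A = q' * (\<delta> i r' * q' + (r' * \<delta> i q' + r' * \<delta> i q'))"
      by (simp add: A_def der_mult[OF psi_Der] power2_eq_square algebra_simps)
    hence "g * \<delta> i A = p' * (\<delta> i r' * q' + (r' * \<delta> i q' + r' * \<delta> i q'))"
      using q' by (simp add: g_def)
    ultimately have 2: "poly_values X Y (p / q * D i (r * q^2)) (g * \<delta> i A)"
      by (simp only: poly_values_mult poly_values.add deriv p q r)
    have "A * \<delta> j (\<psi> i (p / q) a) - \<psi> i (p / q) (A * \<delta> j a)
        = A * \<delta> j g * \<delta> i a - g * \<delta> i A * \<delta> j a"
      using psi_bracket[of j "r * q^2" i "p / q" a]
      unfolding psi_poly[OF f] psi_poly[OF 1] psi_poly[OF 2] .
    moreover have "\<delta> j (g * \<delta> i a) = \<delta> j g * \<delta> i a + g * \<delta> j (\<delta> i a)"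
      by (rule der_mult[OF psi_Der])
    moreover have "\<delta> i (A * \<delta> j a) = \<delta> i A * \<delta> j a + A * \<delta> j (\<delta> i a)"
      by (simp add: der_mult[OF psi_Der] delta_commute[of i j])
    ultimately have "A * \<delta> j (u a) = u (A * \<delta> j a)"
      unfolding u_def g_def[symmetric] der_diff[OF psi_Der] by (simp add: algebra_simps)
    thus ?thesis by (simp only: A_def)
  qed
  have "u (Y k) = 0" for k
  proof -
    let ?w = "\<lambda>a. q'^2 * \<delta> k a"
    have "?w (u a) = u (?w a)" for a
      using comm[OF poly_values_emb[of X Y 1], of k a] by (simp add: emb_1)
    moreover have "Y k * ?w (u a) = u (Y k * ?w a)" for a
      using comm[OF poly_values_var[of X Y k], of k a] by (simp add: mult.assoc)
    \<comment> \<open>The Leibniz rule for \<open>u (Y k * ?w a)\<close> leaves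
      \<open>u (Y k) * ?w a = 0\<close>; at \<open>a = Y k\<close> the second factor is
      \<open>q'^2\<close>.\<close>
    ultimately have "u (Y k) * ?w (Y k) = 0"
      by (simp add: der_mult[OF u])
    thus ?thesis
      using q' by (simp add: delta_Y)
  qed
  moreover obtain f where f: "\<And>a. u a = (\<Sum>k\<in>UNIV. f k * \<delta> k a)"
    using delta_expand[OF u] by blast
  ultimately have "f k = 0" for k
    using f[of "Y k"] by (simp add: delta_Y if_distrib[of "(*) _"] cong: if_cong)
  hence "u a = 0"
    by (simp add: f)
  thus ?thesis by (simp add: u_def)
qed

section \<open>The field automorphism obtained from \<open>\<psi>\<close>\<close>

definition \<sigma> :: "'f \<Rightarrow> 'f" where
  "\<sigma> f = (THE g. \<forall>i a. \<psi> i f a = g * \<delta> i a)"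

lemma sigma_eqI:
  assumes "\<And>i a. \<psi> i f a = g * \<delta> i a"
  shows "\<sigma> f = g"
proof -
  fix i :: 'n
  obtain a where a: "\<delta> i a \<noteq> 0" using delta_nonzero by blast
  show ?thesis
    unfolding \<sigma>_def
  proof (rule the_equality)
    fix h assume "\<forall>i a. \<psi> i f a = h * \<delta> i a"
    hence "h * \<delta> i a = g * \<delta> i a" using assms by metis
    thus "h = g" using a by simp
  qed (simp add: assms)
qed

lemma sigma_quotient:
  assumes "poly_values X Y p p'" and "poly_values X Y q q'" and "q \<noteq> 0"
  shows "\<sigma> (p / q) = p' / q'"
  using psi_quotient[OF assms] by (rule sigma_eqI)

lemma fraction_values: "\<exists>p p' q q'. poly_values X Y p p' \<and> poly_values X Y q q' \<and> q \<noteq> 0 \<and> f = p / q"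
  using fraction[of f] poly_values_exists by blast

lemma psi_eq: "\<psi> i f a = \<sigma> f * \<delta> i a"
  using fraction_values[of f] psi_quotient sigma_quotient by metis

lemma sigma_add: "\<sigma> (f + g) = \<sigma> f + \<sigma> g"
  by (rule sigma_eqI) (simp add: psi_add psi_eq[of _ f] psi_eq[of _ g] distrib_right)

lemma sigma_scale: "\<sigma> (emb c * f) = emb c * \<sigma> f"
  by (rule sigma_eqI) (simp only: psi_scale psi_eq[of _ f] mult.assoc)

lemma sigma_1: "\<sigma> 1 = 1"
  by (rule sigma_eqI) simp

text \<open>Unlike additivity, this is not inherited from \<open>\<psi>\<close>. On fractions of
  polynomials \<open>\<sigma>\<close> is evaluation at \<open>Y\<close>, which respects
  products.\<close>

lemma sigma_mult: "\<sigma> (f * g) = \<sigma> f * \<sigma> g"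
proof -
  obtain p p' q q' where f: "poly_values X Y p p'" "poly_values X Y q q'" "q \<noteq> 0" "f = p / q"
    using fraction_values by blast
  obtain r r' s s' where g: "poly_values X Y r r'" "poly_values X Y s s'" "s \<noteq> 0" "g = r / s"
    using fraction_values by blast
  show ?thesis
    using sigma_quotient[OF poly_values_mult[OF f(1) g(1)] poly_values_mult[OF f(2) g(2)]]
      sigma_quotient[OF f(1,2,3)] sigma_quotient[OF g(1,2,3)] f g by simp
qed

lemma sigma_bij: "bij \<sigma>"
proof (rule bijI)
  fix i :: 'n
  show "inj \<sigma>"
  proof (rule injI)
    fix f g assume "\<sigma> f = \<sigma> g"
    hence "\<psi> i (f + - g) a = 0" for a
      by (simp only: psi_add psi_minus psi_eq[of _ f] psi_eq[of _ g]) simp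
    hence "f + - g = 0" by (rule psi_eq_0)
    thus "f = g" by simp
  qed
  have "\<exists>f. g = \<sigma> f" for g
  proof -
    obtain F where F: "\<And>a. g * \<delta> i a = (\<Sum>k\<in>UNIV. \<psi> k (F k) a)"
      using psi_surj[OF Der_smult[OF psi_Der]] by blast
    \<comment> \<open>Evaluation at \<open>Y i\<close> isolates the coefficient of
      \<open>\<delta> i\<close> on both sides.\<close>
    have "g = \<sigma> (F i)"
      using F[of "Y i"] by (simp add: psi_eq[of _ "F _"] delta_Y if_distrib[of "(*) _"] cong: if_cong)
    thus ?thesis by blast
  qed
  thus "surj \<sigma>" by (auto simp: surj_def)
qed

text \<open>Both sides are the coefficient of \<open>\<delta> k\<close> in the bracket of
  \<open>\<delta> k\<close> with \<open>\<psi> k f\<close>.\<close>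

lemma delta_sigma: "\<delta> k (\<sigma> f) = \<sigma> (D k f)"
proof -
  obtain a where a: "\<delta> k a \<noteq> 0" using delta_nonzero by blast
  have "\<delta> k (\<sigma> f) * \<delta> k a = \<sigma> (D k f) * \<delta> k a"
    using delta_psi[of k k f a] by (simp add: psi_eq[of _ f] psi_eq[of _ "D _ _"] der_mult[OF psi_Der])
  thus ?thesis using a by simp
qed

text \<open>When \<open>\<psi>\<close> comes from a Lie automorphism \<open>\<phi>\<close>, the sum
  is \<open>\<phi> d\<close> applied to \<open>\<sigma> f\<close>, so \<open>\<phi> d\<close> is
  \<open>d\<close> conjugated by \<open>\<sigma>\<close>.\<close>

lemma sigma_Der:
  assumes "d \<in> Der"
  shows "(\<Sum>k\<in>UNIV. \<psi> k (d (X k)) (\<sigma> f)) = \<sigma> (d f)"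
proof -
  have "\<sigma> (sum g A) = (\<Sum>k\<in>A. \<sigma> (g k))" for g and A :: "'n set"
    using sigma_scale[of 0 0] by (induction A rule: infinite_finite_induct) (simp_all add: sigma_add emb_0)
  thus ?thesis
    by (subst (2) Der_expand[OF assms]) (simp add: psi_eq[of _ "d _"] delta_sigma sigma_mult)
qed

end

section \<open>Conjugation by field automorphisms\<close>

context field_algebra
begin

lemma alg_auts_iff:
  "\<sigma> \<in> alg_auts (\<lambda>c. (*) (emb c)) \<longleftrightarrow> bij \<sigma> \<and> (\<forall>a b. \<sigma> (a + b) = \<sigma> a + \<sigma> b) \<and>
    (\<forall>c a. \<sigma> (emb c * a) = emb c * \<sigma> a) \<and> \<sigma> 1 = 1 \<and> (\<forall>a b. \<sigma> (a * b) = \<sigma> a * \<sigma> b)"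
  unfolding alg_auts_def by (auto simp: vector_space_linear_iff[OF vector_space_emb])

lemma inv_alg_auts:
  assumes "\<sigma> \<in> alg_auts (\<lambda>c. (*) (emb c))"
  shows "inv_into UNIV \<sigma> \<in> alg_auts (\<lambda>c. (*) (emb c))"
proof -
  have b: "bij \<sigma>" and s: "\<And>a b. \<sigma> (a + b) = \<sigma> a + \<sigma> b" "\<And>c a. \<sigma> (emb c * a) = emb c * \<sigma> a"
    "\<sigma> 1 = 1" "\<And>a b. \<sigma> (a * b) = \<sigma> a * \<sigma> b"
    using assms by (auto simp: alg_auts_iff)
  have emb: "\<sigma> (emb c) = emb c" for c
    using s(2)[of c 1] by (simp add: s(3))
  note inv = bij_is_inj[OF b] surj_f_inv_f[OF bij_is_surj[OF b]]
  show ?thesis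
    unfolding alg_auts_iff using b
    by (intro conjI allI bij_imp_bij_inv inv_f_eq[OF inv(1)]) (simp_all add: s emb inv(2))
qed

lemma conj_Der:
  assumes "\<sigma> \<in> alg_auts (\<lambda>c. (*) (emb c))" and "d \<in> Der"
  shows "\<sigma> \<circ> d \<circ> inv_into UNIV \<sigma> \<in> Der"
proof -
  have \<sigma>: "bij \<sigma>" "\<And>a b. \<sigma> (a + b) = \<sigma> a + \<sigma> b" "\<And>c a. \<sigma> (emb c * a) = emb c * \<sigma> a"
    "\<And>a b. \<sigma> (a * b) = \<sigma> a * \<sigma> b"
    using assms(1) by (auto simp: alg_auts_iff)
  have inv: "inv_into UNIV \<sigma> (a + b) = inv_into UNIV \<sigma> a + inv_into UNIV \<sigma> b"
    "inv_into UNIV \<sigma> (emb c * a) = emb c * inv_into UNIV \<sigma> a"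
    "inv_into UNIV \<sigma> (a * b) = inv_into UNIV \<sigma> a * inv_into UNIV \<sigma> b" for a b c
    using inv_alg_auts[OF assms(1)] by (auto simp: alg_auts_iff)
  show ?thesis
    unfolding Der_iff comp_def
  proof (intro conjI allI)
    fix a b c
    show "\<sigma> (d (inv_into UNIV \<sigma> (a + b))) = \<sigma> (d (inv_into UNIV \<sigma> a)) + \<sigma> (d (inv_into UNIV \<sigma> b))"
      by (simp only: inv(1) \<sigma>(2) der_add[OF assms(2)])
    show "\<sigma> (d (inv_into UNIV \<sigma> (emb c * a))) = emb c * \<sigma> (d (inv_into UNIV \<sigma> a))"
      by (simp only: inv(2) \<sigma>(3) der_scale[OF assms(2)])
    show "\<sigma> (d (inv_into UNIV \<sigma> (a * b))) = \<sigma> (d (inv_into UNIV \<sigma> a)) * b + a * \<sigma> (d (inv_into UNIV \<sigma> b))"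
      by (simp only: inv(3) \<sigma>(2,4) der_mult[OF assms(2)] surj_f_inv_f[OF bij_is_surj[OF \<sigma>(1)]])
  qed
qed

lemma conj_lie_auts:
  assumes \<sigma>: "\<sigma> \<in> alg_auts (\<lambda>c. (*) (emb c))"
  shows "(\<lambda>d\<in>Der. \<sigma> \<circ> d \<circ> inv_into UNIV \<sigma>) \<in> lie_auts (\<lambda>c. (*) (emb c)) Der"
proof -
  have b: "bij \<sigma>" and add: "\<And>a b. \<sigma> (a + b) = \<sigma> a + \<sigma> b" and scale: "\<And>c a. \<sigma> (emb c * a) = emb c * \<sigma> a"
    using \<sigma> by (auto simp: alg_auts_iff)
  have diff: "\<sigma> (a - b) = \<sigma> a - \<sigma> b" for a b
    using add[of "a - b" b] by simp
  have inv: "inv_into UNIV \<sigma> (\<sigma> a) = a" "\<sigma> (inv_into UNIV \<sigma> a) = a" for a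
    using b by (simp_all add: bij_is_inj bij_is_surj surj_f_inv_f)
  have "bij_betw (\<lambda>d\<in>Der. \<sigma> \<circ> d \<circ> inv_into UNIV \<sigma>) Der Der"
  \<comment> \<open>The inverse map is conjugation by the inverse automorphism.\<close>
  proof (rule bij_betw_byWitness[where f' = "\<lambda>d. inv_into UNIV \<sigma> \<circ> d \<circ> \<sigma>"])
    show "(\<lambda>d\<in>Der. \<sigma> \<circ> d \<circ> inv_into UNIV \<sigma>) ` Der \<subseteq> Der"
      using conj_Der[OF \<sigma>] by auto
    have inv_Der: "inv_into UNIV \<sigma> \<circ> d \<circ> \<sigma> \<in> Der" if "d \<in> Der" for d
      using conj_Der[OF inv_alg_auts[OF \<sigma>] that] by (simp add: inv_inv_eq[OF b])
    thus "(\<lambda>d. inv_into UNIV \<sigma> \<circ> d \<circ> \<sigma>) ` Der \<subseteq> Der"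
      by auto
    show "\<forall>d\<in>Der. inv_into UNIV \<sigma> \<circ> (\<lambda>d\<in>Der. \<sigma> \<circ> d \<circ> inv_into UNIV \<sigma>) d \<circ> \<sigma> = d"
      by (auto simp: inv)
    show "\<forall>d\<in>Der. (\<lambda>d\<in>Der. \<sigma> \<circ> d \<circ> inv_into UNIV \<sigma>) (inv_into UNIV \<sigma> \<circ> d \<circ> \<sigma>) = d"
      using inv_Der by (auto simp: inv)
  qed
  thus ?thesis
    unfolding lie_auts_def Bij_def
    using Der_add Der_smult Der_commutator
    by (auto simp: add scale diff inv commutator_def[of "\<sigma> \<circ> _ \<circ> _"])
      (auto simp: commutator_def diff inv)
qed

end

section \<open>Injectivity and surjectivity of the conjugation map\<close>

context rational_function_field
begin

text \<open>Passing from \<open>D i\<close> to \<open>f\<close> times \<open>D i\<close> multiplies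
  the conjugates by \<open>\<sigma> f\<close> and \<open>\<tau> f\<close> respectively; these are
  compared at \<open>\<sigma> (X i)\<close>, where the common conjugate of \<open>D i\<close> has
  the value 1.\<close>

lemma conj_inject:
  assumes \<sigma>: "\<sigma> \<in> alg_auts (\<lambda>c. (*) (emb c))" and \<tau>: "\<tau> \<in> alg_auts (\<lambda>c. (*) (emb c))"
    and eq: "\<And>d. d \<in> Der \<Longrightarrow> \<sigma> \<circ> d \<circ> inv_into UNIV \<sigma> = \<tau> \<circ> d \<circ> inv_into UNIV \<tau>"
  shows "\<sigma> = \<tau>"
proof
  fix f
  fix i :: 'n
  have eq1: "\<sigma> (D i (inv_into UNIV \<sigma> a)) = \<tau> (D i (inv_into UNIV \<tau> a))" for a
    using fun_cong[OF eq[OF D]] by simp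
  have "\<sigma> f * \<sigma> (D i (inv_into UNIV \<sigma> a)) = \<tau> f * \<tau> (D i (inv_into UNIV \<tau> a))" for a
    using fun_cong[OF eq[OF Der_smult[OF D[of i], of f]], of a] \<sigma> \<tau> by (simp add: alg_auts_iff)
  from this[of "\<sigma> (X i)"] eq1[of "\<sigma> (X i)"] show "\<sigma> f = \<tau> f"
    using \<sigma> by (simp add: alg_auts_iff bij_is_inj D_X)
qed

lemma lie_aut_conj:
  assumes "\<phi> \<in> lie_auts (\<lambda>c. (*) (emb c)) Der"
  obtains \<sigma> where "\<sigma> \<in> alg_auts (\<lambda>c. (*) (emb c))" and "\<phi> = (\<lambda>d\<in>Der. \<sigma> \<circ> d \<circ> inv_into UNIV \<sigma>)"
proof -
  have ext: "\<phi> \<in> extensional Der" and bij: "bij_betw \<phi> Der Der"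
    and add: "\<And>d e. d \<in> Der \<Longrightarrow> e \<in> Der \<Longrightarrow> \<phi> (\<lambda>a. d a + e a) = (\<lambda>a. \<phi> d a + \<phi> e a)"
    and scale: "\<And>c d. d \<in> Der \<Longrightarrow> \<phi> (\<lambda>a. emb c * d a) = (\<lambda>a. emb c * \<phi> d a)"
    and comm: "\<And>d e. d \<in> Der \<Longrightarrow> e \<in> Der \<Longrightarrow> \<phi> (commutator d e) = commutator (\<phi> d) (\<phi> e)"
    using assms by (auto simp: lie_auts_def Bij_def)
  have zero: "\<phi> (\<lambda>a. 0) = (\<lambda>a. 0)"
    using scale[OF Der_zero, of 0] by (simp add: emb_0)
  have sum: "\<phi> (\<lambda>a. \<Sum>k\<in>A. d k a) = (\<lambda>a. \<Sum>k\<in>A. \<phi> (d k) a)" if "\<And>k. d k \<in> Der" for d and A :: "'n set"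
    by (induction A rule: infinite_finite_induct) (simp_all add: zero add that Der_sum)
  define \<psi> where "\<psi> i f = \<phi> (\<lambda>a. f * D i a)" for i f
  have sum_psi: "\<phi> (\<lambda>a. \<Sum>k\<in>UNIV. F k * D k a) = (\<lambda>a. \<Sum>k\<in>UNIV. \<psi> k (F k) a)" for F
    unfolding \<psi>_def by (rule sum) (rule Der_smult[OF D])
  interpret L: lie_transport emb X D \<psi>
  proof
    fix i j f g a c
    show "\<psi> i f \<in> Der"
      unfolding \<psi>_def by (rule bij_betw_apply[OF bij Der_smult[OF D]])
    show "\<psi> i (f + g) a = \<psi> i f a + \<psi> i g a"
      unfolding \<psi>_def by (simp add: distrib_right add[OF Der_smult[OF D] Der_smult[OF D]])
    show "\<psi> i (emb c * f) a = emb c * \<psi> i f a"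
      unfolding \<psi>_def by (simp add: scale[OF Der_smult[OF D]] mult.assoc)
    \<comment> \<open>The difference is written with the scalar \<open>emb (- 1)\<close> because
      \<open>add\<close> and \<open>scale\<close> describe \<open>\<phi>\<close> on sums and scalar
      multiples.\<close>
    have "commutator (\<lambda>a. f * D i a) (\<lambda>a. g * D j a) = (\<lambda>a. f * D i g * D j a + emb (- 1) * (g * D j f * D i a))"
      by (simp add: fun_eq_iff commutator_def der_mult[OF D] D_commute[of i j] emb_minus emb_1 algebra_simps)
    hence "commutator (\<psi> i f) (\<psi> j g) = (\<lambda>a. \<psi> j (f * D i g) a + emb (- 1) * \<psi> i (g * D j f) a)"
      unfolding \<psi>_def comm[OF Der_smult[OF D] Der_smult[OF D], symmetric]
      by (simp only: add[OF Der_smult[OF D] Der_smult[OF Der_smult[OF D]]] scale[OF Der_smult[OF D]])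
    thus "\<psi> i f (\<psi> j g a) - \<psi> j g (\<psi> i f a) = \<psi> j (f * D i g) a - \<psi> i (g * D j f) a"
      by (simp add: commutator_def fun_eq_iff emb_minus emb_1)
  next
    fix F i
    assume "\<And>a. (\<Sum>k\<in>UNIV. \<psi> k (F k) a) = 0"
    hence "\<phi> (\<lambda>a. \<Sum>k\<in>UNIV. F k * D k a) = \<phi> (\<lambda>a. 0)"
      by (simp add: sum_psi zero)
    hence "(\<lambda>a. \<Sum>k\<in>UNIV. F k * D k a) = (\<lambda>a. 0)"
      using Der_sum[OF Der_smult[OF D]] Der_zero by (rule inj_onD[OF bij_betw_imp_inj_on[OF bij]])
    from fun_cong[OF this, of "X i"] show "F i = 0"
      by (simp add: D_X if_distrib[of "(*) _"] cong: if_cong)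
  next
    fix d assume "d \<in> Der"
    then obtain e where e: "e \<in> Der" "d = \<phi> e"
      using bij_betw_imp_surj_on[OF bij] by blast
    \<comment> \<open>The coefficients of the preimage \<open>e\<close> in the basis
      \<open>D k\<close> serve as \<open>F\<close>.\<close>
    have "d = (\<lambda>a. \<Sum>k\<in>UNIV. \<psi> k (e (X k)) a)"
      unfolding e(2) sum_psi[symmetric] Der_expand[OF e(1), symmetric] ..
    thus "\<exists>F. \<forall>a. d a = (\<Sum>k\<in>UNIV. \<psi> k (F k) a)"
      by auto
  qed
  have "L.\<sigma> \<in> alg_auts (\<lambda>c. (*) (emb c))"
    unfolding alg_auts_iff
    by (intro conjI allI) (rule L.sigma_bij L.sigma_add L.sigma_scale L.sigma_1 L.sigma_mult)+
  moreover have "\<phi> = (\<lambda>d\<in>Der. L.\<sigma> \<circ> d \<circ> inv_into UNIV L.\<sigma>)"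
  proof (rule extensionalityI[OF ext])
    fix d assume d: "d \<in> Der"
    have "\<phi> d = (\<lambda>a. \<Sum>k\<in>UNIV. \<psi> k (d (X k)) a)"
      unfolding sum_psi[symmetric] Der_expand[OF d, symmetric] ..
    hence "\<phi> d (L.\<sigma> f) = L.\<sigma> (d f)" for f
      by (simp add: L.sigma_Der[OF d])
    from this[of "inv_into UNIV L.\<sigma> _"] have "\<phi> d a = L.\<sigma> (d (inv_into UNIV L.\<sigma> a))" for a
      by (simp add: surj_f_inv_f[OF bij_is_surj[OF L.sigma_bij]])
    thus "\<phi> d = (\<lambda>d\<in>Der. L.\<sigma> \<circ> d \<circ> inv_into UNIV L.\<sigma>) d"
      using d by (simp add: fun_eq_iff)
  qed simp
  ultimately show ?thesis by (rule that)
qed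

lemma conj_iso:
  "(\<lambda>\<sigma>. \<lambda>d\<in>Der. \<sigma> \<circ> d \<circ> inv_into UNIV \<sigma>)
    \<in> iso (alg_aut_group (\<lambda>c. (*) (emb c))) (lie_aut_group (\<lambda>c. (*) (emb c)) Der)"
  (is "?h \<in> _")
proof (rule isoI)
  have car: "carrier (alg_aut_group (\<lambda>c. (*) (emb c))) = alg_auts (\<lambda>c. (*) (emb c))"
    "carrier (lie_aut_group (\<lambda>c. (*) (emb c)) Der) = lie_auts (\<lambda>c. (*) (emb c)) Der"
    by (simp_all add: alg_aut_group_def lie_aut_group_def)
  show "?h \<in> hom (alg_aut_group (\<lambda>c. (*) (emb c))) (lie_aut_group (\<lambda>c. (*) (emb c)) Der)"
  proof (rule homI)
    fix \<sigma> \<tau>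
    assume "\<sigma> \<in> carrier (alg_aut_group (\<lambda>c. (*) (emb c)))" "\<tau> \<in> carrier (alg_aut_group (\<lambda>c. (*) (emb c)))"
    hence \<sigma>: "\<sigma> \<in> alg_auts (\<lambda>c. (*) (emb c))" and \<tau>: "\<tau> \<in> alg_auts (\<lambda>c. (*) (emb c))"
      by (simp_all add: car)
    hence bij: "bij \<sigma>" "bij \<tau>" by (simp_all add: alg_auts_iff)
    have Bij: "?h \<rho> \<in> Bij Der" if "\<rho> \<in> alg_auts (\<lambda>c. (*) (emb c))" for \<rho>
      using conj_lie_auts[OF that] by (simp add: lie_auts_def)
    have "\<sigma> \<otimes>\<^bsub>alg_aut_group (\<lambda>c. (*) (emb c))\<^esub> \<tau> = \<sigma> \<circ> \<tau>"
      using bij by (simp add: alg_aut_group_def BijGroup_def Bij_def compose_def comp_def restrict_UNIV)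
    moreover have "?h \<sigma> \<otimes>\<^bsub>lie_aut_group (\<lambda>c. (*) (emb c)) Der\<^esub> ?h \<tau> = compose Der (?h \<sigma>) (?h \<tau>)"
      using Bij[OF \<sigma>] Bij[OF \<tau>] by (simp add: lie_aut_group_def BijGroup_def)
    moreover have "?h (\<sigma> \<circ> \<tau>) = compose Der (?h \<sigma>) (?h \<tau>)"
      unfolding compose_def
      by (rule restrict_ext) (simp add: conj_Der[OF \<tau>, unfolded comp_assoc] o_inv_distrib[OF bij] comp_assoc)
    ultimately show "?h (\<sigma> \<otimes>\<^bsub>alg_aut_group (\<lambda>c. (*) (emb c))\<^esub> \<tau>)
        = ?h \<sigma> \<otimes>\<^bsub>lie_aut_group (\<lambda>c. (*) (emb c)) Der\<^esub> ?h \<tau>"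
      by simp
  qed (simp add: car conj_lie_auts)
  show "bij_betw ?h (carrier (alg_aut_group (\<lambda>c. (*) (emb c)))) (carrier (lie_aut_group (\<lambda>c. (*) (emb c)) Der))"
    unfolding car
  proof (rule bij_betw_imageI)
    show "inj_on ?h (alg_auts (\<lambda>c. (*) (emb c)))"
    proof (rule inj_onI)
      fix \<sigma> \<tau>
      assume *: "\<sigma> \<in> alg_auts (\<lambda>c. (*) (emb c))" "\<tau> \<in> alg_auts (\<lambda>c. (*) (emb c))" and eq: "?h \<sigma> = ?h \<tau>"
      show "\<sigma> = \<tau>"
      proof (rule conj_inject[OF *])
        fix d assume "d \<in> Der"
        thus "\<sigma> \<circ> d \<circ> inv_into UNIV \<sigma> = \<tau> \<circ> d \<circ> inv_into UNIV \<tau>"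
          using fun_cong[OF eq, of d] by (simp only: restrict_apply if_True)
      qed
    qed
    show "?h ` alg_auts (\<lambda>c. (*) (emb c)) = lie_auts (\<lambda>c. (*) (emb c)) Der"
    proof (intro equalityI subsetI)
      fix \<phi> assume "\<phi> \<in> lie_auts (\<lambda>c. (*) (emb c)) Der"
      then obtain \<sigma> where "\<sigma> \<in> alg_auts (\<lambda>c. (*) (emb c))" "\<phi> = ?h \<sigma>"
        by (rule lie_aut_conj)
      thus "\<phi> \<in> ?h ` alg_auts (\<lambda>c. (*) (emb c))"
        by (intro image_eqI)
    qed (use conj_lie_auts in blast)
  qed
qed

end

section \<open>The field of rational functions\<close>

text \<open>The partial derivative by the \<open>i\<close>-th variable, read off coefficientwise:
  the monomial with exponent \<open>\<alpha>\<close> arises from the one whose \<open>i\<close>-th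
  exponent is larger by one.\<close>

lift_definition poly_deriv ::
    "'n \<Rightarrow> (('n \<Rightarrow>\<^sub>0 nat) \<Rightarrow>\<^sub>0 'k::comm_semiring_1) \<Rightarrow> (('n \<Rightarrow>\<^sub>0 nat) \<Rightarrow>\<^sub>0 'k)"
  is "\<lambda>i p \<alpha>. of_nat (Suc (Poly_Mapping.lookup \<alpha> i)) * p (\<alpha> + Poly_Mapping.single i 1)"
proof -
  fix i :: 'n and p :: "('n \<Rightarrow>\<^sub>0 nat) \<Rightarrow> 'k"
  assume "finite {\<alpha>. p \<alpha> \<noteq> 0}"
  hence "finite ((\<lambda>\<alpha>. \<alpha> + Poly_Mapping.single i 1) -` {\<alpha>. p \<alpha> \<noteq> 0})"
    by (rule finite_vimageI) (simp add: inj_on_def)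
  thus "finite {\<alpha>. of_nat (Suc (Poly_Mapping.lookup \<alpha> i)) * p (\<alpha> + Poly_Mapping.single i 1) \<noteq> 0}"
    by (rule rev_finite_subset) auto
qed

lemma poly_deriv_add: "poly_deriv i (p + q) = poly_deriv i p + poly_deriv i q"
  by (rule poly_mapping_eqI) (simp add: poly_deriv.rep_eq lookup_add distrib_left)

lemma poly_deriv_0: "poly_deriv i 0 = 0"
  by (rule poly_mapping_eqI) (simp add: poly_deriv.rep_eq)

lemma poly_deriv_single:
  "poly_deriv i (Poly_Mapping.single \<alpha> c)
    = Poly_Mapping.single (\<alpha> - Poly_Mapping.single i 1) (of_nat (Poly_Mapping.lookup \<alpha> i) * c)"
proof (rule poly_mapping_eqI)
  fix \<beta>
  have "\<alpha> = \<beta> + Poly_Mapping.single i 1 \<longleftrightarrow> Poly_Mapping.lookup \<alpha> i \<noteq> 0 \<and> \<alpha> - Poly_Mapping.single i 1 = \<beta>"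
    by (auto simp: poly_mapping_eq_iff fun_eq_iff lookup_add lookup_minus lookup_single when_def)
  thus "Poly_Mapping.lookup (poly_deriv i (Poly_Mapping.single \<alpha> c)) \<beta>
      = Poly_Mapping.lookup (Poly_Mapping.single (\<alpha> - Poly_Mapping.single i 1) (of_nat (Poly_Mapping.lookup \<alpha> i) * c)) \<beta>"
    by (cases "\<alpha> = \<beta> + Poly_Mapping.single i 1") (auto simp: poly_deriv.rep_eq lookup_single when_def lookup_add)
qed

lemma poly_mapping_single_induct [case_names zero add]:
  fixes p :: "'a \<Rightarrow>\<^sub>0 'b::comm_monoid_add"
  assumes "P 0" and "\<And>p \<alpha> c. P p \<Longrightarrow> P (Poly_Mapping.single \<alpha> c + p)"
  shows "P p"
proof -
  have "P (\<Sum>\<alpha>\<in>A. Poly_Mapping.single \<alpha> (Poly_Mapping.lookup p \<alpha>))" if "finite A" for A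
    using that by induction (simp_all add: assms)
  moreover have "(\<Sum>\<alpha>\<in>Poly_Mapping.keys p. Poly_Mapping.single \<alpha> (Poly_Mapping.lookup p \<alpha>)) = p"
    by (rule poly_mapping_eqI) (simp add: lookup_sum lookup_single when_def in_keys_iff)
  ultimately show ?thesis by (metis finite_keys)
qed

lemma poly_deriv_single_mult_single:
  "poly_deriv i (Poly_Mapping.single \<alpha> c * Poly_Mapping.single \<beta> d)
    = poly_deriv i (Poly_Mapping.single \<alpha> c) * Poly_Mapping.single \<beta> d
      + Poly_Mapping.single \<alpha> c * poly_deriv i (Poly_Mapping.single \<beta> d)"
proof -
  \<comment> \<open>Truncated subtraction commutes with adding \<open>\<beta>\<close> only if
    \<open>\<alpha>\<close> is nonzero at \<open>i\<close>; otherwise the coefficients in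
    \<open>1\<close> and \<open>2\<close> are zero.\<close>
  have shift: "Poly_Mapping.lookup \<alpha> i \<noteq> 0 \<Longrightarrow> \<alpha> - Poly_Mapping.single i 1 + \<beta> = \<alpha> + \<beta> - Poly_Mapping.single i 1"
    for \<alpha> \<beta> :: "'a \<Rightarrow>\<^sub>0 nat"
    by (auto simp: poly_mapping_eq_iff fun_eq_iff lookup_add lookup_minus lookup_single when_def)
  have 1: "Poly_Mapping.single (\<alpha> - Poly_Mapping.single i 1 + \<beta>) (of_nat (Poly_Mapping.lookup \<alpha> i) * c * d)
      = Poly_Mapping.single (\<alpha> + \<beta> - Poly_Mapping.single i 1) (of_nat (Poly_Mapping.lookup \<alpha> i) * c * d)"
    using shift[of \<alpha> \<beta>] by (cases "Poly_Mapping.lookup \<alpha> i = 0") simp_all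
  have 2: "Poly_Mapping.single (\<alpha> + (\<beta> - Poly_Mapping.single i 1)) (c * (of_nat (Poly_Mapping.lookup \<beta> i) * d))
      = Poly_Mapping.single (\<alpha> + \<beta> - Poly_Mapping.single i 1) (c * (of_nat (Poly_Mapping.lookup \<beta> i) * d))"
    using shift[of \<beta> \<alpha>] by (cases "Poly_Mapping.lookup \<beta> i = 0") (simp_all add: add.commute)
  show ?thesis
    unfolding poly_deriv_single mult_single 1 2 single_add[symmetric]
    by (simp add: lookup_add algebra_simps)
qed

lemma poly_deriv_mult:
  "poly_deriv i (p * q) = poly_deriv i p * q + p * poly_deriv i q"
proof (induction p rule: poly_mapping_single_induct)
  case (add p \<alpha> c)
  have "poly_deriv i (Poly_Mapping.single \<alpha> c * q)
      = poly_deriv i (Poly_Mapping.single \<alpha> c) * q + Poly_Mapping.single \<alpha> c * poly_deriv i q"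
    by (induction q rule: poly_mapping_single_induct)
      (simp_all add: poly_deriv_0 poly_deriv_add poly_deriv_single_mult_single algebra_simps)
  thus ?case
    using add by (simp add: distrib_right poly_deriv_add algebra_simps)
qed (simp add: poly_deriv_0)

lemma poly_deriv_eq_0_imp_const:
  fixes p :: "('n \<Rightarrow>\<^sub>0 nat) \<Rightarrow>\<^sub>0 'k::field_char_0"
  assumes "\<And>i. poly_deriv i p = 0"
  shows "p = Poly_Mapping.single 0 (Poly_Mapping.lookup p 0)"
proof (rule poly_mapping_eqI)
  fix \<alpha>
  show "Poly_Mapping.lookup p \<alpha> = Poly_Mapping.lookup (Poly_Mapping.single 0 (Poly_Mapping.lookup p 0)) \<alpha>"
  proof (cases "\<alpha> = 0")
    case False
    then obtain i where i: "Poly_Mapping.lookup \<alpha> i \<noteq> 0"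
      by (auto simp: poly_mapping_eq_iff fun_eq_iff)
    hence "\<alpha> - Poly_Mapping.single i 1 + Poly_Mapping.single i 1 = \<alpha>"
      by (auto simp: poly_mapping_eq_iff fun_eq_iff lookup_add lookup_minus lookup_single when_def)
    \<comment> \<open>This coefficient is the one of \<open>p\<close> at \<open>\<alpha>\<close>
      times the \<open>i\<close>-th exponent, a nonzero number in characteristic 0.\<close>
    moreover have "Poly_Mapping.lookup (poly_deriv i p) (\<alpha> - Poly_Mapping.single i 1) = 0"
      by (simp add: assms)
    ultimately have "Poly_Mapping.lookup p \<alpha> = 0"
      unfolding poly_deriv.rep_eq by (simp del: of_nat_Suc)
    thus ?thesis using False by (simp add: lookup_single)
  qed simp
qed

text \<open>The quotient on the right is independent of \<open>a\<close> and \<open>b\<close> only if \<open>d\<close> satisfies the Leibniz rule.\<close>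

definition fract_deriv :: "('a::idom \<Rightarrow> 'a) \<Rightarrow> 'a fract \<Rightarrow> 'a fract" where
  "fract_deriv d x = (THE y. \<forall>a b. b \<noteq> 0 \<longrightarrow> x = Fract a b \<longrightarrow> y = Fract (d a * b - a * d b) (b * b))"

context
  fixes d :: "'a::idom \<Rightarrow> 'a"
  assumes mult: "\<And>a b. d (a * b) = d a * b + a * d b"
begin

lemma fract_deriv_Fract:
  assumes b: "b \<noteq> 0"
  shows "fract_deriv d (Fract a b) = Fract (d a * b - a * d b) (b * b)"
  unfolding fract_deriv_def
proof (rule the_equality, intro allI impI)
  fix a' b'
  assume b': "b' \<noteq> 0" and "Fract a b = Fract a' b'"
  hence eq: "a * b' = a' * b"
    using b by (simp add: eq_fract)
  \<comment> \<open>Independence of the representative comes from differentiating the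
    cross-multiplied equality.\<close>
  have "d a * b' + a * d b' = d a' * b + a' * d b"
    using arg_cong[OF eq, of d] by (simp add: mult)
  with eq have "(d a * b - a * d b) * (b' * b') = (d a' * b' - a' * d b') * (b * b)"
    by algebra
  thus "Fract (d a * b - a * d b) (b * b) = Fract (d a' * b' - a' * d b') (b' * b')"
    using b b' by (simp add: eq_fract)
qed (use b in blast)

lemma fract_deriv_add:
  assumes add: "\<And>a b. d (a + b) = d a + d b"
  shows "fract_deriv d (x + y) = fract_deriv d x + fract_deriv d y"
proof -
  obtain a b a' b' where *: "x = Fract a b" "b \<noteq> 0" "y = Fract a' b'" "b' \<noteq> 0"
    by (metis Fract_cases)
  thus ?thesis
    by (simp add: fract_deriv_Fract assms mult eq_fract algebra_simps)
qed

lemma fract_deriv_mult: "fract_deriv d (x * y) = fract_deriv d x * y + x * fract_deriv d y"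
proof -
  obtain a b a' b' where *: "x = Fract a b" "b \<noteq> 0" "y = Fract a' b'" "b' \<noteq> 0"
    by (metis Fract_cases)
  thus ?thesis
    by (simp add: fract_deriv_Fract mult eq_fract algebra_simps)
qed

lemma fract_deriv_Fract_1: "fract_deriv d (Fract a 1) = Fract (d a) 1"
proof -
  have "d 1 = 0"
    using mult[of 1 1] by (metis add_cancel_right_right mult_1 mult_1_right)
  thus ?thesis by (simp add: fract_deriv_Fract)
qed

end

section \<open>Rational functions with their partial derivatives as an instance\<close>

interpretation rf: field_algebra "rf_const :: 'k::field_char_0 \<Rightarrow> ('k, 'n::{finite,linorder}) rat_fun"
  by unfold_locales (rule rf_const_0 rf_const_1 rf_const_add rf_const_mult)+

definition rf_var :: "'n \<Rightarrow> ('k::field_char_0, 'n::{finite,linorder}) rat_fun" where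
  "rf_var j = Fract (Poly_Mapping.single (Poly_Mapping.single j 1) 1) 1"

definition rf_deriv :: "'n \<Rightarrow> ('k::field_char_0, 'n::{finite,linorder}) rat_fun \<Rightarrow> ('k, 'n) rat_fun" where
  "rf_deriv i = fract_deriv (poly_deriv i)"

lemma rf_deriv_Fract:
  "b \<noteq> 0 \<Longrightarrow> rf_deriv i (Fract a b) = Fract (poly_deriv i a * b - a * poly_deriv i b) (b * b)"
  unfolding rf_deriv_def by (rule fract_deriv_Fract[OF poly_deriv_mult])

lemma rf_deriv_Fract_1: "rf_deriv i (Fract a 1) = Fract (poly_deriv i a) 1"
  unfolding rf_deriv_def by (rule fract_deriv_Fract_1[OF poly_deriv_mult])

lemma rf_deriv_const: "rf_deriv i (rf_const c) = 0"
  by (simp add: rf_const_def rf_deriv_Fract_1 poly_deriv_single Zero_fract_def)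

lemma rf_deriv_Der:
  fixes i :: "'n::{finite,linorder}"
  shows "(rf_deriv i :: ('k::field_char_0, 'n) rat_fun \<Rightarrow> _) \<in> rf.Der"
proof -
  have add: "rf_deriv i (a + b) = rf_deriv i a + rf_deriv i b"
    and mult: "rf_deriv i (a * b) = rf_deriv i a * b + a * rf_deriv i b" for a b :: "('k, 'n) rat_fun"
    unfolding rf_deriv_def
    by (rule fract_deriv_add[OF poly_deriv_mult poly_deriv_add] fract_deriv_mult[OF poly_deriv_mult])+
  show ?thesis
    unfolding rf.Der_iff by (simp add: add mult rf_deriv_const)
qed

lemma rf_deriv_var: "rf_deriv i (rf_var j) = (if j = i then 1 else 0)"
  by (auto simp: rf_var_def rf_deriv_Fract_1 poly_deriv_single lookup_single Zero_fract_def One_fract_def)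

text \<open>If all derivatives of \<open>a / b\<close> vanish, then \<open>a / b\<close> is also the
  quotient of the \<open>i\<close>-th derivatives of \<open>a\<close> and \<open>b\<close> whenever
  that of \<open>b\<close> is nonzero. This lowers the degree of the denominator until it is
  constant, and then the numerator is constant too.\<close>

lemma rf_deriv_eq_0_imp_const:
  fixes f :: "('k::field_char_0, 'n::{finite,linorder}) rat_fun"
  assumes const: "\<And>i. rf_deriv i f = 0"
  shows "f \<in> range rf_const"
proof -
  \<comment> \<open>The bound \<open>m\<close> on the degrees in \<open>b\<close> is strict, so
    \<open>m = 0\<close> would force \<open>b = 0\<close>.\<close>
  have "f \<in> range rf_const"
    if "b \<noteq> 0" "f = Fract a b" "\<And>\<alpha>. \<alpha> \<in> Poly_Mapping.keys b \<Longrightarrow> sum (Poly_Mapping.lookup \<alpha>) UNIV < m" for m a b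
    using that
  proof (induction m arbitrary: a b)
    case 0
    hence "Poly_Mapping.keys b = {}" by blast
    thus ?case using \<open>b \<noteq> 0\<close> by simp
  next
    case (Suc m)
    have eq: "poly_deriv i a * b = a * poly_deriv i b" for i
      using const[of i] Suc.prems(1,2) by (simp add: rf_deriv_Fract Zero_fract_def eq_fract)
    show ?case
    proof (cases "\<forall>i. poly_deriv i b = 0")
      case True
      define \<beta> where "\<beta> = Poly_Mapping.lookup b 0"
      have b: "b = Poly_Mapping.single 0 \<beta>"
        unfolding \<beta>_def by (rule poly_deriv_eq_0_imp_const) (simp add: True)
      have "poly_deriv i a = 0" for i
        using eq[of i] True Suc.prems(1) by simp
      then obtain \<gamma> where a: "a = Poly_Mapping.single 0 \<gamma>"
        using poly_deriv_eq_0_imp_const by blast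
      have "f = rf_const (\<gamma> / \<beta>)"
        using Suc.prems(1,2) unfolding rf_const_def a b by (auto simp: eq_fract mult_single)
      thus ?thesis by blast
    next
      case False
      then obtain i where i: "poly_deriv i b \<noteq> 0" by blast
      show ?thesis
      proof (rule Suc.IH[OF i])
        show "f = Fract (poly_deriv i a) (poly_deriv i b)"
          using Suc.prems(1,2) i eq[of i] by (simp add: eq_fract)
      next
        fix \<alpha> assume "\<alpha> \<in> Poly_Mapping.keys (poly_deriv i b)"
        hence "\<alpha> + Poly_Mapping.single i 1 \<in> Poly_Mapping.keys b"
          by (auto simp: in_keys_iff poly_deriv.rep_eq)
        hence "sum (Poly_Mapping.lookup (\<alpha> + Poly_Mapping.single i 1)) UNIV < Suc m"
          by (rule Suc.prems(3))
        moreover have "sum (Poly_Mapping.lookup (\<alpha> + Poly_Mapping.single i 1)) UNIV = Suc (sum (Poly_Mapping.lookup \<alpha>) UNIV)"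
          by (simp add: lookup_add sum.distrib lookup_single when_def)
        ultimately show "sum (Poly_Mapping.lookup \<alpha>) UNIV < m" by simp
      qed
    qed
  qed
  moreover obtain a b where "f = Fract a b" "b \<noteq> 0"
    by (metis Fract_cases)
  \<comment> \<open>The sum of the degrees of all monomials of \<open>b\<close> is a crude bound to
    start the induction.\<close>
  moreover have "sum (Poly_Mapping.lookup \<alpha>) UNIV < Suc (\<Sum>\<alpha>\<in>Poly_Mapping.keys b. sum (Poly_Mapping.lookup \<alpha>) UNIV)" if "\<alpha> \<in> Poly_Mapping.keys b" for \<alpha>
    using member_le_sum[OF that, of "\<lambda>\<alpha>. sum (Poly_Mapping.lookup \<alpha>) UNIV"] by simp
  ultimately show ?thesis by blast
qed

lemma Fract_single:
  fixes c :: "'k::field_char_0" and \<alpha> :: "'n::{finite,linorder} \<Rightarrow>\<^sub>0 nat"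
  shows "Fract (Poly_Mapping.single \<alpha> c) 1 = rf_const c * monom_at rf_var (Poly_Mapping.lookup \<alpha>)"
proof -
  have power: "rf_var k ^ m = Fract (Poly_Mapping.single (Poly_Mapping.single k m) (1::'k)) 1" for k m
    by (induction m) (simp_all add: rf_var_def One_fract_def mult_single single_add[symmetric])
  have "(\<Prod>k\<in>A. rf_var k ^ Poly_Mapping.lookup \<alpha> k)
      = Fract (Poly_Mapping.single (\<Sum>k\<in>A. Poly_Mapping.single k (Poly_Mapping.lookup \<alpha> k)) (1::'k)) 1" for A
    by (induction A rule: infinite_finite_induct) (simp_all add: power One_fract_def mult_single)
  moreover have "(\<Sum>k\<in>UNIV. Poly_Mapping.single k (Poly_Mapping.lookup \<alpha> k)) = \<alpha>"
    by (rule poly_mapping_eqI) (simp add: lookup_sum lookup_single when_def)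
  ultimately have "monom_at rf_var (Poly_Mapping.lookup \<alpha>) = Fract (Poly_Mapping.single \<alpha> (1::'k)) 1"
    by (simp add: monom_at_def)
  thus ?thesis
    by (simp add: rf_const_def mult_single)
qed

lemma Fract_polynomial_in: "rf.polynomial_in rf_var (Fract p 1)"
proof (induction p rule: poly_mapping_single_induct)
  case zero
  show ?case using rf.poly_values_emb[of _ _ 0] by (simp add: rf_const_0 Zero_fract_def)
next
  case (add p \<alpha> c)
  have "Fract (Poly_Mapping.single \<alpha> c + p) 1 = rf_const c * monom_at rf_var (Poly_Mapping.lookup \<alpha>) + Fract p 1"
    unfolding Fract_single[symmetric] by simp
  thus ?case
    using rf.poly_values.intros add by metis
qed

interpretation rf: rational_function_field
  "rf_const :: 'k::field_char_0 \<Rightarrow> ('k, 'n::{finite,linorder}) rat_fun" rf_var rf_deriv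
proof
  fix f :: "('k, 'n) rat_fun"
  obtain a b where "f = Fract a b" "b \<noteq> 0"
    by (metis Fract_cases)
  hence "f = Fract a 1 / Fract b 1" "Fract b 1 \<noteq> 0"
    by (simp_all add: Zero_fract_def eq_fract)
  thus "\<exists>p q. rf.polynomial_in rf_var p \<and> rf.polynomial_in rf_var q \<and> q \<noteq> 0 \<and> f = p / q"
    using Fract_polynomial_in by blast
qed (rule rf_deriv_Der rf_deriv_var rf_deriv_eq_0_imp_const; assumption?)+

theorem theorem1p2:
  shows "(\<lambda>\<sigma>. \<lambda>d\<in>derivations rf_scale. \<sigma> \<circ> d \<circ> inv_into UNIV \<sigma>)
    \<in> iso
        (alg_aut_group
          (rf_scale :: 'k::field_char_0 \<Rightarrow> ('k, 'n::{finite,linorder}) rat_fun \<Rightarrow> ('k, 'n) rat_fun))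
        (lie_aut_group
          (rf_scale :: 'k \<Rightarrow> ('k, 'n) rat_fun \<Rightarrow> ('k, 'n) rat_fun)
          (derivations rf_scale))"
proof -
  have eq: "(rf_scale :: 'k \<Rightarrow> ('k, 'n) rat_fun \<Rightarrow> _) = (\<lambda>c. (*) (rf_const c))"
    by (simp add: fun_eq_iff rf_scale_def)
  show ?thesis
    unfolding eq by (rule rf.conj_iso)
qed

end
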